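(* Let $A\in\mathbb{R}^{m\times n}$, $B\in\mathbb{R}^{p\times q}$, $F\in\mathbb{R}^{m\times q}$. Put $Y^{\ast}=A^{\dag}F\in\mathbb{R}^{n\times q}$ and $X^{\ast}=A^{\dag}FB^{\dag}\in\mathbb{R}^{n\times p}$. Assume that the matrix equations $AY=F$ (unknown $Y\in\mathbb{R}^{n\times q}$) and $XB=Y^{\ast}$ (unknown $X\in\mathbb{R}^{n\times p}$) are consistent. Let $S=\{U_0,\dots,U_{s-1}\}$ be a row random partition of $[m]$ with $s$ blocks and $T=\{V_0,\dots,V_{t-1}\}$ a column random partition of $[q]$ with $t$ blocks. Let $\beta_A>0$ be an upper paving bound for $A$ with respect to $S$, and let $\alpha_B>0$ and $\beta_B>0$ be lower and upper paving bounds for $B$ with respect to $T$. Let $X^{(0)}\in\mathbb{R}^{n\times p}$ and $Y^{(0)}=X^{(0)}B\in\mathbb{R}^{n\times q}$ be such that $X^{(0)}=ZB^{T}$ for some $Z\in\mathbb{R}^{n\times q}$ and $Y^{(0)}=A^{T}Z'$ for some $Z'\in\mathbb{R}^{m\times q}$. Set $$\widehat{\gamma}=1-\frac{\sigma_{\min}^2(A)}{s\beta_A},\qquad \widetilde{\gamma}=1-\frac{\sigma_{\min}^2(B)}{t\beta_B},$$ and assume $\widetilde\gamma\neq 0$. Then the sequence $\{X^{(k)}\}_{k\ge 0}$ generated by the ARBK method converges linearly to $X^{\ast}$ in mean square. Moreover, for every $k\ge 0$, $$E\left[\|X^{(k+1)}-X^{\ast}\|_F^2\right]\le \overline{\gamma}_k\,\widetilde{\gamma}^{\,k+1}\,\|X^{(0)}-X^{\ast}\|_F^2,\qquad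 \overline{\gamma}_k=1+\frac{\sigma_{\max}^2(B)}{t\alpha_B}\sum_{\ell=0}^{k}\frac{\widehat{\gamma}^{\,\ell+1}}{\widetilde{\gamma}^{\,\ell+1}}.$$
   Context: Notation: $[n]=\{1,\dots,n\}$. $M^{\dag}$ is the Moore-Penrose pseudoinverse, $\|\cdot\|_F$ the Frobenius norm, and $\sigma_{\max}(M),\sigma_{\min}(M)$ the maximum and minimum singular values of $M$. $M_{U,:}$ and $M_{:,V}$ are the submatrices of $M$ formed by the rows indexed by $U$, respectively the columns indexed by $V$. $\lambda_{\min},\lambda_{\max}$ denote the smallest and largest eigenvalues of a symmetric matrix. Random partitions: for a permutation $\pi_U$ of $[m]$ chosen uniformly at random and $1\le s\le m$, the row random partition of $[m]$ with $s$ blocks is $S=\{U_0,\dots,U_{s-1}\}$ with $U_{i-1}=\{\pi_U(k): k=\lfloor (i-1)m/s\rfloor+1,\dots,\lfloor im/s\rfloor\}$ for $i=1,\dots,s$. Likewise, for a uniformly random permutation $\pi_V$ of $[q]$ and $1\le t\le q$, the column random partition of $[q]$ with $t$ blocks is $T=\{V_0,\dots,V_{t-1}\}$ with $V_{j-1}=\{\pi_V(k): k=\lfloor (j-1)q/t\rfloor+1,\dots,\lfloor jq/t\rfloor\}$ for $j=1,\dots,t$. The partitions $S$ and $T$ are inputs of the algorithm: they are drawn once and then fixed, and the expectation $E$ is over the random block selections made in the iterations. Paving bounds: $\beta_A$ is an upper paving bound for $A$ with respect to $S$ if $\lambda_{\max}(A_{U,:}A_{U,:}^T)\le\beta_A$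 for every $U\in S$. $\alpha_B$ and $\beta_B$ are lower and upper paving bounds for $B$ with respect to $T$ if $\alpha_B\le\lambda_{\min}(B_{:,V}^TB_{:,V})$ and $\lambda_{\max}(B_{:,V}^TB_{:,V})\le\beta_B$ for every $V\in T$. ARBK (alternating randomized block Kaczmarz) method for $AXB=F$: given $X^{(0)}$ and $Y^{(0)}=X^{(0)}B$, for $k=0,1,2,\dots$ select $U_{i_k}\in S$ uniformly at random and compute $$Y^{(k+1)}=Y^{(k)}+A_{U_{i_k},:}^{\dag}\left(F_{U_{i_k},:}-A_{U_{i_k},:}Y^{(k)}\right);$$ then select $V_{j_k}\in T$ uniformly at random and compute $$X^{(k+1)}=X^{(k)}+\left(Y^{(k+1)}_{:,V_{j_k}}-X^{(k)}B_{:,V_{j_k}}\right)B_{:,V_{j_k}}^{\dag}.$$ All random selections are mutually independent. Linear convergence in mean square of $X^{(k)}$ to $X^{\ast}$ means that there exist $C\ge 0$ and $\rho\in[0,1)$ with $E[\|X^{(k)}-X^{\ast}\|_F^2]\le C\rho^k$ for all $k\ge 0$. *)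

theory Defs
  imports
    "HOL-Probability.Independent_Family"
    "HOL-Probability.Probability_Mass_Function"
    "HOL-Combinatorics.Permutations"
    "Jordan_Normal_Form.Char_Poly"
    "Jordan_Normal_Form.DL_Submatrix"
begin

text \<open>
  Matrices are those of the entry Jordan_Normal_Form, so row and column indices start at 0
  and the index set of the rows of an m-row matrix is {..<m}.
\<close>

definition frobenius_norm :: "real mat \<Rightarrow> real" where
  "frobenius_norm M = sqrt (\<Sum>i<dim_row M. \<Sum>j<dim_col M. (M $$ (i, j))\<^sup>2)"

definition penrose_inverse :: "real mat \<Rightarrow> real mat \<Rightarrow> bool" where
  "penrose_inverse M P \<longleftrightarrow>
     P \<in> carrier_mat (dim_col M) (dim_row M) \<and>
     M * P * M = M \<and> P * M * P = P \<and>
     transpose_mat (M * P) = M * P \<and> transpose_mat (P * M) = P * M"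

definition pinv :: "real mat \<Rightarrow> real mat" where
  "pinv M = (THE P. penrose_inverse M P)"

text \<open>Only meaningful for nonempty symmetric matrices.\<close>

definition lambda_min :: "real mat \<Rightarrow> real" where
  "lambda_min M = Min {e. eigenvalue M e}"

definition lambda_max :: "real mat \<Rightarrow> real" where
  "lambda_max M = Max {e. eigenvalue M e}"

text \<open>
  An m by n matrix has min(m,n) singular values, zeros included: the square roots of the
  eigenvalues of the smaller of its two Gram matrices.  (The larger one has additional zero
  eigenvalues that are not squares of singular values.)
\<close>

definition singular_values :: "real mat \<Rightarrow> real set" where
  "singular_values M =
     sqrt ` {e. eigenvalue (if dim_row M \<le> dim_col M then M * transpose_mat M
                            else transpose_mat M * M) e}"

definition sigma_min :: "real mat \<Rightarrow> real" where
  "sigma_min M = Min (singular_values M)"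

definition sigma_max :: "real mat \<Rightarrow> real" where
  "sigma_max M = Max (singular_values M)"

definition rows_of :: "real mat \<Rightarrow> nat set \<Rightarrow> real mat" where
  "rows_of M U = submatrix M U UNIV"

definition cols_of :: "real mat \<Rightarrow> nat set \<Rightarrow> real mat" where
  "cols_of M V = submatrix M UNIV V"

text \<open>
  In 1-based terms, block number i (counted from 0) of the partition of [m] into s blocks given
  by \<open>\<pi>\<close> consists of the \<open>\<pi>(k)\<close> with \<open>\<lfloor>i m / s\<rfloor> + 1 \<le> k \<le> \<lfloor>(i + 1) m / s\<rfloor>\<close>;
  shifting k by one gives the half-open interval below.
\<close>

definition part_block :: "(nat \<Rightarrow> nat) \<Rightarrow> nat \<Rightarrow> nat \<Rightarrow> nat \<Rightarrow> nat set" where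
  "part_block \<pi> m s i = \<pi> ` {i * m div s ..< (i + 1) * m div s}"

definition upper_row_paving_bound :: "real mat \<Rightarrow> nat set set \<Rightarrow> real \<Rightarrow> bool" where
  "upper_row_paving_bound A S \<beta> \<longleftrightarrow>
     (\<forall>U\<in>S. lambda_max (rows_of A U * transpose_mat (rows_of A U)) \<le> \<beta>)"

definition lower_col_paving_bound :: "real mat \<Rightarrow> nat set set \<Rightarrow> real \<Rightarrow> bool" where
  "lower_col_paving_bound B T \<alpha> \<longleftrightarrow>
     (\<forall>V\<in>T. \<alpha> \<le> lambda_min (transpose_mat (cols_of B V) * cols_of B V))"

definition upper_col_paving_bound :: "real mat \<Rightarrow> nat set set \<Rightarrow> real \<Rightarrow> bool" where
  "upper_col_paving_bound B T \<beta> \<longleftrightarrow>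
     (\<forall>V\<in>T. lambda_max (transpose_mat (cols_of B V) * cols_of B V) \<le> \<beta>)"

definition arbk_Y_step :: "real mat \<Rightarrow> real mat \<Rightarrow> nat set \<Rightarrow> real mat \<Rightarrow> real mat" where
  "arbk_Y_step A F U Y = Y + pinv (rows_of A U) * (rows_of F U - rows_of A U * Y)"

definition arbk_X_step :: "real mat \<Rightarrow> nat set \<Rightarrow> real mat \<Rightarrow> real mat \<Rightarrow> real mat" where
  "arbk_X_step B V Y X = X + (cols_of Y V - X * cols_of B V) * pinv (cols_of B V)"

text \<open>
  The pair of iterates \<open>(X\<^sup>(\<^sup>k\<^sup>), Y\<^sup>(\<^sup>k\<^sup>))\<close> when the row block \<open>U (i k)\<close> and the column block
  \<open>V (j k)\<close> are selected in iteration k.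
\<close>

primrec arbk ::
  "real mat \<Rightarrow> real mat \<Rightarrow> real mat \<Rightarrow> (nat \<Rightarrow> nat set) \<Rightarrow> (nat \<Rightarrow> nat set) \<Rightarrow>
   real mat \<Rightarrow> real mat \<Rightarrow> (nat \<Rightarrow> nat) \<Rightarrow> (nat \<Rightarrow> nat) \<Rightarrow> nat \<Rightarrow> real mat \<times> real mat" where
  "arbk A B F U V X0 Y0 i j 0 = (X0, Y0)"
| "arbk A B F U V X0 Y0 i j (Suc k) =
     (let (X, Y) = arbk A B F U V X0 Y0 i j k;
          Y' = arbk_Y_step A F (U (i k)) Y
      in (arbk_X_step B (V (j k)) Y' X, Y'))"

definition uniform_selection :: "'w measure \<Rightarrow> nat \<Rightarrow> ('w \<Rightarrow> nat) \<Rightarrow> bool" where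
  "uniform_selection M s i \<longleftrightarrow>
     distr M (count_space UNIV) i = measure_pmf (pmf_of_set {..<s})"

text \<open>All the selections \<open>i 0, i 1, \<dots>, j 0, j 1, \<dots>\<close> form one jointly independent family.\<close>

definition random_selections ::
  "'w measure \<Rightarrow> nat \<Rightarrow> nat \<Rightarrow> (nat \<Rightarrow> 'w \<Rightarrow> nat) \<Rightarrow> (nat \<Rightarrow> 'w \<Rightarrow> nat) \<Rightarrow> bool" where
  "random_selections M s t i j \<longleftrightarrow>
     (\<forall>k. uniform_selection M s (i k)) \<and> (\<forall>k. uniform_selection M t (j k)) \<and>
     prob_space.indep_vars M (\<lambda>_. count_space UNIV) (case_sum i j) UNIV"

text \<open>
  Integrability is required explicitly because the Bochner integral of a non-integrable function
  is 0, which would satisfy the bound vacuously.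
\<close>

definition linear_mean_square_convergence ::
  "'w measure \<Rightarrow> (nat \<Rightarrow> 'w \<Rightarrow> real mat) \<Rightarrow> real mat \<Rightarrow> bool" where
  "linear_mean_square_convergence M X L \<longleftrightarrow>
     (\<forall>k. integrable M (\<lambda>\<omega>. (frobenius_norm (X k \<omega> - L))\<^sup>2)) \<and>
     (\<exists>C \<rho>. 0 \<le> C \<and> 0 \<le> \<rho> \<and> \<rho> < 1 \<and>
        (\<forall>k. (\<integral>\<omega>. (frobenius_norm (X k \<omega> - L))\<^sup>2 \<partial>M) \<le> C * \<rho> ^ k))"

end

theory Submission
  imports Defs
begin

text \<open>
  Let \<open>E = Y - Y\<^sup>*\<close> and \<open>D = X - X\<^sup>*\<close>. As \<open>A Y\<^sup>* = F\<close>, a row step replaces \<open>E\<close> by its residual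
  \<open>E - A\<^sub>U\<^sup>\<dagger> A\<^sub>U E\<close>, which is orthogonal to the part removed; by the paving bound the squared norm drops
  by at least \<open>\<parallel>A\<^sub>U E\<parallel>\<^sup>2 / \<beta>A\<close>. Summed over the blocks these drops are \<open>\<parallel>A E\<parallel>\<^sup>2 / \<beta>A\<close>, and
  \<open>\<parallel>A E\<parallel> \<ge> sigma_min A \<parallel>E\<parallel>\<close> because the columns of \<open>E\<close> never leave the row space of \<open>A\<close>.
  As \<open>X\<^sup>* B = Y\<^sup>*\<close>, a column step splits \<open>D\<close> orthogonally into the residual \<open>D - D B\<^sub>V B\<^sub>V\<^sup>\<dagger>\<close>,
  treated like the row step after transposition, and \<open>E\<^sub>V B\<^sub>V\<^sup>\<dagger>\<close>, of squared norm at most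
  \<open>\<parallel>E\<^sub>V\<parallel>\<^sup>2 / \<alpha>B\<close>. For the expectations \<open>e\<close> and \<open>d\<close> of \<open>\<parallel>E\<parallel>\<^sup>2\<close> and \<open>\<parallel>D\<parallel>\<^sup>2\<close> this gives
  \<open>e (k + 1) \<le> \<gamma>hat e k\<close> and \<open>d (k + 1) \<le> \<gamma>tilde d k + e (k + 1) / (t \<alpha>B)\<close>, and solving the recursion
  yields the explicit bound. The factors \<open>\<gamma>hat\<close> and \<open>\<gamma>tilde\<close> can be 1; linear convergence follows
  from the same recursion with \<open>(sigma_min A)\<^sup>2\<close> and \<open>(sigma_min B)\<^sup>2\<close> replaced by positive constants
  valid on the ranges in which the errors live.
\<close>

section \<open>The Frobenius inner product\<close>

definition mat_inner :: "real mat \<Rightarrow> real mat \<Rightarrow> real" where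
  "mat_inner C D = (\<Sum>i<dim_row C. \<Sum>j<dim_col C. C $$ (i, j) * D $$ (i, j))"

lemma mat_inner_carrier:
  "C \<in> carrier_mat r c \<Longrightarrow> mat_inner C D = (\<Sum>i<r. \<Sum>j<c. C $$ (i, j) * D $$ (i, j))"
  by (auto simp: mat_inner_def)

lemma frobenius_norm_power2: "(frobenius_norm C)\<^sup>2 = mat_inner C C"
  unfolding frobenius_norm_def mat_inner_def
  by (subst real_sqrt_pow2) (auto intro!: sum_nonneg simp: power2_eq_square)

lemma mat_inner_self_nonneg: "0 \<le> mat_inner C C"
  by (auto simp: mat_inner_def intro!: sum_nonneg)

lemma mat_inner_self_eq_0D:
  assumes C: "C \<in> carrier_mat r c" and 0: "mat_inner C C = 0"
  shows "C = 0\<^sub>m r c"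
proof (rule eq_matI)
  fix i j assume "i < dim_row (0\<^sub>m r c :: real mat)" "j < dim_col (0\<^sub>m r c :: real mat)"
  then have ij: "i < r" "j < c" by auto
  have "(\<Sum>j<c. C $$ (i, j) * C $$ (i, j)) = 0"
    using 0[unfolded mat_inner_carrier[OF C]] ij
    by (subst (asm) sum_nonneg_eq_0_iff) (auto intro!: sum_nonneg)
  then have "C $$ (i, j) * C $$ (i, j) = 0"
    using ij by (subst (asm) sum_nonneg_eq_0_iff) auto
  then show "C $$ (i, j) = 0\<^sub>m r c $$ (i, j)" using ij by simp
qed (use C in auto)

lemma mat_inner_commute:
  "C \<in> carrier_mat r c \<Longrightarrow> D \<in> carrier_mat r c \<Longrightarrow> mat_inner C D = mat_inner D C"
  by (simp add: mat_inner_carrier mult.commute)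

lemma mat_inner_add_left:
  "C \<in> carrier_mat r c \<Longrightarrow> D \<in> carrier_mat r c \<Longrightarrow> E \<in> carrier_mat r c \<Longrightarrow>
    mat_inner (C + D) E = mat_inner C E + mat_inner D E"
  by (auto simp: mat_inner_def sum.distrib[symmetric] algebra_simps intro!: sum.cong)

lemma mat_inner_add_right:
  "C \<in> carrier_mat r c \<Longrightarrow> D \<in> carrier_mat r c \<Longrightarrow> E \<in> carrier_mat r c \<Longrightarrow>
    mat_inner E (C + D) = mat_inner E C + mat_inner E D"
  by (auto simp: mat_inner_def sum.distrib[symmetric] algebra_simps intro!: sum.cong)

lemma mat_inner_minus_left:
  "C \<in> carrier_mat r c \<Longrightarrow> D \<in> carrier_mat r c \<Longrightarrow> E \<in> carrier_mat r c \<Longrightarrow>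
    mat_inner (C - D) E = mat_inner C E - mat_inner D E"
  by (auto simp: mat_inner_def sum_subtractf[symmetric] algebra_simps intro!: sum.cong)

lemma mat_inner_minus_right:
  "C \<in> carrier_mat r c \<Longrightarrow> D \<in> carrier_mat r c \<Longrightarrow> E \<in> carrier_mat r c \<Longrightarrow>
    mat_inner E (C - D) = mat_inner E C - mat_inner E D"
  by (auto simp: mat_inner_def sum_subtractf[symmetric] algebra_simps intro!: sum.cong)

lemma mat_inner_smult_left:
  "C \<in> carrier_mat r c \<Longrightarrow> D \<in> carrier_mat r c \<Longrightarrow> mat_inner (a \<cdot>\<^sub>m C) D = a * mat_inner C D"
  by (auto simp: mat_inner_def sum_distrib_left algebra_simps intro!: sum.cong)

lemma mat_inner_smult_right:
  "C \<in> carrier_mat r c \<Longrightarrow> D \<in> carrier_mat r c \<Longrightarrow> mat_inner C (a \<cdot>\<^sub>m D) = a * mat_inner C D"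
  by (auto simp: mat_inner_def sum_distrib_left algebra_simps intro!: sum.cong)

lemma mat_inner_transpose:
  assumes "C \<in> carrier_mat r c" "D \<in> carrier_mat r c"
  shows "mat_inner (transpose_mat C) (transpose_mat D) = mat_inner C D"
proof -
  have "mat_inner (transpose_mat C) (transpose_mat D) = (\<Sum>j<c. \<Sum>i<r. C $$ (i, j) * D $$ (i, j))"
    using assms by (auto simp: mat_inner_def intro!: sum.cong)
  also have "\<dots> = mat_inner C D"
    unfolding mat_inner_carrier[OF assms(1)] by (rule sum.swap)
  finally show ?thesis .
qed

lemma index_mult_mat_sum:
  "M \<in> carrier_mat r k \<Longrightarrow> C \<in> carrier_mat k c \<Longrightarrow> i < r \<Longrightarrow> j < c \<Longrightarrow>
    (M * C) $$ (i, j) = (\<Sum>l<k. M $$ (i, l) * C $$ (l, j))"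
  by (auto simp: scalar_prod_def lessThan_atLeast0 intro!: sum.cong)

lemma mat_inner_mult_left:
  assumes M: "M \<in> carrier_mat r k" and C: "C \<in> carrier_mat k c" and D: "D \<in> carrier_mat r c"
  shows "mat_inner (M * C) D = mat_inner C (transpose_mat M * D)"
proof -
  have "mat_inner (M * C) D = (\<Sum>i<r. \<Sum>j<c. \<Sum>l<k. M $$ (i, l) * C $$ (l, j) * D $$ (i, j))"
    unfolding mat_inner_carrier[OF mult_carrier_mat[OF M C]]
    by (intro sum.cong refl) (simp add: index_mult_mat_sum[OF M C] sum_distrib_right del: index_mult_mat)
  also have "\<dots> = (\<Sum>j<c. \<Sum>l<k. \<Sum>i<r. M $$ (i, l) * C $$ (l, j) * D $$ (i, j))"
    by (subst sum.swap) (intro sum.cong refl sum.swap)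
  also have "\<dots> = (\<Sum>l<k. \<Sum>j<c. \<Sum>i<r. M $$ (i, l) * C $$ (l, j) * D $$ (i, j))"
    by (rule sum.swap)
  also have "\<dots> = mat_inner C (transpose_mat M * D)"
    unfolding mat_inner_carrier[OF C] using M
    by (intro sum.cong refl)
      (simp add: index_mult_mat_sum[of "transpose_mat M" k r D c] D sum_distrib_left algebra_simps
        del: index_mult_mat)
  finally show ?thesis .
qed

lemma mat_inner_Cauchy_Schwarz:
  assumes C: "C \<in> carrier_mat r c" and D: "D \<in> carrier_mat r c"
  shows "(mat_inner C D)\<^sup>2 \<le> mat_inner C C * mat_inner D D"
proof -
  have "mat_inner X Y = (\<Sum>x\<in>{..<r} \<times> {..<c}. X $$ x * Y $$ x)" if "X \<in> carrier_mat r c" for X Y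
    unfolding mat_inner_carrier[OF that] by (simp add: sum.cartesian_product case_prod_unfold)
  then show ?thesis
    using Cauchy_Schwarz_ineq_sum[of "\<lambda>x. C $$ x" "\<lambda>x. D $$ x" "{..<r} \<times> {..<c}"] C D
    by (simp add: power2_eq_square)
qed

text \<open>Submultiplicativity of the Frobenius norm: Cauchy-Schwarz is applied to each entry of
  the product, and the resulting double sum factors.\<close>

lemma mat_inner_mult_le:
  assumes M: "M \<in> carrier_mat r k" and C: "C \<in> carrier_mat k c"
  shows "mat_inner (M * C) (M * C) \<le> mat_inner M M * mat_inner C C"
proof -
  have "mat_inner (M * C) (M * C)
      = (\<Sum>i<r. \<Sum>j<c. (\<Sum>l<k. M $$ (i, l) * C $$ (l, j))\<^sup>2)"
    unfolding mat_inner_carrier[OF mult_carrier_mat[OF M C]]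
    by (intro sum.cong refl) (simp add: index_mult_mat_sum[OF M C] power2_eq_square del: index_mult_mat)
  also have "\<dots> \<le> (\<Sum>i<r. \<Sum>j<c. (\<Sum>l<k. (M $$ (i, l))\<^sup>2) * (\<Sum>l<k. (C $$ (l, j))\<^sup>2))"
    by (intro sum_mono Cauchy_Schwarz_ineq_sum)
  also have "\<dots> = (\<Sum>i<r. \<Sum>l<k. (M $$ (i, l))\<^sup>2) * (\<Sum>j<c. \<Sum>l<k. (C $$ (l, j))\<^sup>2)"
    by (simp add: sum_product)
  also have "(\<Sum>j<c. \<Sum>l<k. (C $$ (l, j))\<^sup>2) = mat_inner C C"
    unfolding mat_inner_carrier[OF C] power2_eq_square by (rule sum.swap)
  finally show ?thesis unfolding mat_inner_carrier[OF M] power2_eq_square .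
qed

section \<open>Extreme eigenvalues of symmetric matrices\<close>

text \<open>Cauchy-Schwarz combined with submultiplicativity. This crude two-sided bound makes the
  set of lower bounds of the Rayleigh quotient nonempty and supplies a safe step length in the
  coercivity argument.\<close>

lemma mat_inner_mult_bound:
  assumes N: "N \<in> carrier_mat n n" and Z: "Z \<in> carrier_mat n k"
  shows "\<bar>mat_inner Z (N * Z)\<bar> \<le> frobenius_norm N * mat_inner Z Z"
proof (rule abs_le_square_iff[THEN iffD2, THEN order_trans])
  have NZ: "N * Z \<in> carrier_mat n k" using N Z by simp
  have "(mat_inner Z (N * Z))\<^sup>2 \<le> mat_inner Z Z * mat_inner (N * Z) (N * Z)"
    by (rule mat_inner_Cauchy_Schwarz[OF Z NZ])
  also have "\<dots> \<le> mat_inner Z Z * (mat_inner N N * mat_inner Z Z)"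
    by (intro mult_left_mono mat_inner_mult_le[OF N Z] mat_inner_self_nonneg)
  also have "\<dots> = (frobenius_norm N * mat_inner Z Z)\<^sup>2"
    by (simp add: power_mult_distrib frobenius_norm_power2) (simp add: power2_eq_square)
  finally show "(mat_inner Z (N * Z))\<^sup>2 \<le> (frobenius_norm N * mat_inner Z Z)\<^sup>2" .
  show "\<bar>frobenius_norm N * mat_inner Z Z\<bar> \<le> frobenius_norm N * mat_inner Z Z"
    by (auto simp: frobenius_norm_def mat_inner_self_nonneg intro!: mult_nonneg_nonneg sum_nonneg)
qed

text \<open>A short step against the gradient \<open>K * Z\<close> cannot make a nonnegative form
  negative, which bounds the squared norm of \<open>K * Z\<close> by a multiple of the form at
  \<open>Z\<close>. Invertibility then bounds \<open>Z\<close> by \<open>K * Z\<close>. Neither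
  eigenvectors nor compactness enter.\<close>

lemma nonsingular_psd_coercive:
  fixes K :: "real mat"
  assumes K: "K \<in> carrier_mat n n" and sym: "transpose_mat K = K" and det: "det K \<noteq> 0"
    and psd: "\<And>Z. Z \<in> carrier_mat n k \<Longrightarrow> 0 \<le> mat_inner Z (K * Z)"
  shows "\<exists>\<delta>>0. \<forall>Z\<in>carrier_mat n k. \<delta> * mat_inner Z Z \<le> mat_inner Z (K * Z)"
proof -
  obtain L where L: "L \<in> carrier_mat n n" "L * K = 1\<^sub>m n"
    using det_non_zero_imp_unit[OF K det, of "()"] by (auto simp: Units_def ring_mat_def)
  define \<kappa> where "\<kappa> = frobenius_norm K + 1"
  have \<kappa>: "\<kappa> > 0"
    unfolding \<kappa>_def frobenius_norm_def by (smt (verit) real_sqrt_ge_zero sum_nonneg zero_le_power2)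
  define \<nu> where "\<nu> = mat_inner L L + 1"
  have \<nu>: "\<nu> > 0" using mat_inner_self_nonneg[of L] by (simp add: \<nu>_def)
  have "1 / (\<nu> * \<kappa>) * mat_inner Z Z \<le> mat_inner Z (K * Z)" if Z: "Z \<in> carrier_mat n k" for Z
  proof -
    define W where "W = K * Z"
    have W: "W \<in> carrier_mat n k" using K Z by (simp add: W_def)
    have KW: "K * W \<in> carrier_mat n k" using K W by simp
    define x where "x = 1 / \<kappa>"
    have xW: "x \<cdot>\<^sub>m W \<in> carrier_mat n k" using W by simp
    have ZKW: "mat_inner Z (K * W) = mat_inner W W"
      using mat_inner_mult_left[OF K Z W] sym by (simp add: W_def)
    \<comment> \<open>replacing \<open>Z\<close> by \<open>Z - K Z / \<kappa>\<close> decreases the form by at least \<open>\<parallel>K Z\<parallel>\<^sup>2 / \<kappa>\<close>,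
      and the form stays nonnegative\<close>
    have "0 \<le> mat_inner (Z - x \<cdot>\<^sub>m W) (K * (Z - x \<cdot>\<^sub>m W))"
      using xW by (intro psd minus_carrier_mat)
    also have "K * (Z - x \<cdot>\<^sub>m W) = W - x \<cdot>\<^sub>m (K * W)"
      using mult_minus_distrib_mat[OF K Z xW] mult_smult_distrib[OF K W, of x] by (simp add: W_def)
    also have "mat_inner (Z - x \<cdot>\<^sub>m W) (W - x \<cdot>\<^sub>m (K * W))
        = mat_inner Z W - 2 * x * mat_inner W W + x\<^sup>2 * mat_inner W (K * W)"
      using Z W KW
      by (simp add: minus_carrier_mat mat_inner_minus_left[where r=n and c=k] mat_inner_minus_right[where r=n and c=k]
          mat_inner_smult_left[where r=n and c=k] mat_inner_smult_right[where r=n and c=k] ZKW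
          power2_eq_square algebra_simps)
    also have "\<dots> \<le> mat_inner Z W - 2 * x * mat_inner W W + x\<^sup>2 * (\<kappa> * mat_inner W W)"
      using mat_inner_mult_bound[OF K W] mat_inner_self_nonneg[of W]
      by (intro add_left_mono mult_left_mono) (auto simp: \<kappa>_def algebra_simps)
    also have "\<dots> = mat_inner Z W - mat_inner W W / \<kappa>"
      using \<kappa> by (simp add: x_def power2_eq_square field_simps)
    finally have 1: "mat_inner W W \<le> \<kappa> * mat_inner Z W" using \<kappa> by (simp add: field_simps)
    have "Z = L * W" unfolding W_def using L K Z by (simp add: assoc_mult_mat[symmetric, of L n n K n Z k])
    then have "mat_inner Z Z \<le> mat_inner L L * mat_inner W W"
      using mat_inner_mult_le[OF L(1) W] by simp
    also have "\<dots> \<le> \<nu> * mat_inner W W"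
      by (intro mult_right_mono mat_inner_self_nonneg) (simp add: \<nu>_def)
    also have "\<dots> \<le> \<nu> * (\<kappa> * mat_inner Z W)" using 1 \<nu> by simp
    finally show ?thesis using \<nu> \<kappa> by (simp add: W_def field_simps)
  qed
  then show ?thesis using \<nu> \<kappa> by (intro exI[of _ "1 / (\<nu> * \<kappa>)"]) auto
qed

text \<open>
  Takes the place of the spectral theorem: the largest \<open>\<mu>\<close> below the Rayleigh quotient of \<open>N\<close> is an
  eigenvalue, since otherwise \<open>N - \<mu>\<close> would be nonsingular, hence coercive, and \<open>\<mu>\<close> could be increased.
\<close>

lemma symmetric_eigenvalue_lower_bound:
  fixes N :: "real mat" and n k :: nat
  assumes N: "N \<in> carrier_mat n n" and sym: "transpose_mat N = N" and n: "0 < n" and k: "0 < k"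
  shows "\<exists>\<mu>. eigenvalue N \<mu> \<and> (\<forall>Z\<in>carrier_mat n k. \<mu> * mat_inner Z Z \<le> mat_inner Z (N * Z))"
proof -
  define C where "C = {c. \<forall>Z\<in>carrier_mat n k. c * mat_inner Z Z \<le> mat_inner Z (N * Z)}"
  have "- frobenius_norm N \<in> C"
    unfolding C_def using mat_inner_mult_bound[OF N] by (auto simp: abs_le_iff minus_le_iff)
  then have ne: "C \<noteq> {}" by auto
  \<comment> \<open>Any nonzero test matrix bounds \<open>C\<close> above by its Rayleigh quotient;
    the all-ones matrix is nonzero because \<open>n\<close> and \<open>k\<close> are
    positive.\<close>
  define J where "J = mat n k (\<lambda>_. 1 :: real)"
  have J: "J \<in> carrier_mat n k" by (simp add: J_def)
  have J1: "mat_inner J J = real n * real k" by (simp add: mat_inner_def J_def)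
  have J0: "mat_inner J J > 0" using n k by (simp add: J1)
  have bdd: "bdd_above C"
    unfolding bdd_above_def C_def using J J0
    by (intro exI[of _ "mat_inner J (N * J) / mat_inner J J"]) (auto simp: field_simps)
  define \<mu> where "\<mu> = Sup C"
  \<comment> \<open>For each \<open>Z\<close> the constraint on \<open>c\<close> is closed, so the
    supremum satisfies it too. Dividing by the squared norm requires treating the zero matrix
    separately.\<close>
  have \<mu>: "\<mu> \<in> C"
    unfolding C_def
  proof (intro CollectI ballI)
    fix Z :: "real mat" assume Z: "Z \<in> carrier_mat n k"
    show "\<mu> * mat_inner Z Z \<le> mat_inner Z (N * Z)"
    proof (cases "mat_inner Z Z = 0")
      case True
      then have "Z = 0\<^sub>m n k" by (rule mat_inner_self_eq_0D[OF Z])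
      then show ?thesis using True N by (simp add: mat_inner_def)
    next
      case False
      then have pos: "mat_inner Z Z > 0" using mat_inner_self_nonneg[of Z] by simp
      have "\<mu> \<le> mat_inner Z (N * Z) / mat_inner Z Z"
        unfolding \<mu>_def using Z pos by (intro cSup_least[OF ne]) (auto simp: C_def field_simps)
      then show ?thesis using pos by (simp add: field_simps)
    qed
  qed
  define K where "K = char_matrix N \<mu>"
  have K: "K \<in> carrier_mat n n" using N by (simp add: K_def)
  have K_eq: "K = N - \<mu> \<cdot>\<^sub>m 1\<^sub>m n"
    using N unfolding K_def char_matrix_def by (intro eq_matI) auto
  have symK: "transpose_mat K = K"
  proof -
    have "transpose_mat (\<mu> \<cdot>\<^sub>m 1\<^sub>m n) = \<mu> \<cdot>\<^sub>m 1\<^sub>m n" by (intro eq_matI) auto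
    then show ?thesis
      unfolding K_eq using sym transpose_minus[OF N, of "\<mu> \<cdot>\<^sub>m 1\<^sub>m n"] by simp
  qed
  have form: "mat_inner Z (K * Z) = mat_inner Z (N * Z) - \<mu> * mat_inner Z Z"
    if Z: "Z \<in> carrier_mat n k" for Z
  proof -
    have "K * Z = N * Z - \<mu> \<cdot>\<^sub>m Z"
      unfolding K_eq using minus_mult_distrib_mat[OF N _ Z, of "\<mu> \<cdot>\<^sub>m 1\<^sub>m n"] Z
      mult_smult_assoc_mat[OF one_carrier_mat Z, of \<mu>] by simp
    then show ?thesis
      using N Z by (simp add: mat_inner_minus_right[where r=n and c=k] mat_inner_smult_right[where r=n and c=k])
  qed
  have "det K = 0"
  proof (rule ccontr)
    assume "det K \<noteq> 0"
    then obtain \<delta> where \<delta>: "\<delta> > 0" "\<forall>Z\<in>carrier_mat n k. \<delta> * mat_inner Z Z \<le> mat_inner Z (K * Z)"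
      using nonsingular_psd_coercive[OF K symK, of k] \<mu> by (auto simp: form C_def)
    then have "\<mu> + \<delta> \<in> C" by (auto simp: C_def form algebra_simps)
    then have "\<mu> + \<delta> \<le> \<mu>" unfolding \<mu>_def by (rule cSup_upper[OF _ bdd])
    then show False using \<delta> by simp
  qed
  then have "eigenvalue N \<mu>" by (simp add: eigenvalue_det[OF N] K_def)
  with \<mu> show ?thesis by (auto simp: C_def)
qed

section \<open>Bounds on quadratic forms by the least and greatest eigenvalue\<close>

lemma finite_eigenvalues:
  fixes N :: "real mat"
  assumes "N \<in> carrier_mat n n"
  shows "finite {e. eigenvalue N e}"
proof -
  have "char_poly N \<noteq> 0" using degree_monic_char_poly[OF assms] by auto
  then show ?thesis using poly_roots_finite by (simp add: eigenvalue_root_char_poly[OF assms])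
qed

lemma eigenvalue_uminus:
  fixes N :: "real mat"
  assumes N: "N \<in> carrier_mat n n" and "eigenvalue (- N) e"
  shows "eigenvalue N (- e)"
proof -
  obtain v where v: "v \<in> carrier_vec n" "v \<noteq> 0\<^sub>v n" "(- N) *\<^sub>v v = e \<cdot>\<^sub>v v"
    using assms by (auto simp: eigenvalue_def eigenvector_def)
  have "- (- N *\<^sub>v v) = - (e \<cdot>\<^sub>v v)" using v(3) by simp
  moreover have "- (e \<cdot>\<^sub>v v) = (- e) \<cdot>\<^sub>v v" by (intro eq_vecI) auto
  ultimately have "N *\<^sub>v v = (- e) \<cdot>\<^sub>v v" using N v(1) by simp
  then show ?thesis unfolding eigenvalue_def eigenvector_def using v N by auto
qed

lemma lambda_min_le:
  assumes N: "N \<in> carrier_mat n n" and sym: "transpose_mat N = N" and n: "0 < n"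
    and Z: "Z \<in> carrier_mat n k"
  shows "lambda_min N * mat_inner Z Z \<le> mat_inner Z (N * Z)"
proof (cases "k = 0")
  \<comment> \<open>The existence of a bounding eigenvalue is available for at least one column;
    without columns both sides are 0.\<close>
  case True
  then show ?thesis using Z by (simp add: mat_inner_def)
next
  case False
  then obtain \<mu> where \<mu>: "eigenvalue N \<mu>" "\<mu> * mat_inner Z Z \<le> mat_inner Z (N * Z)"
    using symmetric_eigenvalue_lower_bound[OF N sym n] Z by blast
  have "lambda_min N \<le> \<mu>"
    unfolding lambda_min_def using \<mu>(1) by (intro Min_le finite_eigenvalues[OF N]) simp
  then have "lambda_min N * mat_inner Z Z \<le> \<mu> * mat_inner Z Z"
    by (intro mult_right_mono mat_inner_self_nonneg)
  with \<mu>(2) show ?thesis by simp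
qed

text \<open>The lower bound is applied to \<open>- N\<close>: the eigenvalue \<mu> found there gives
  the eigenvalue \<open>- \<mu>\<close> of \<open>N\<close>, which is at most the maximum.\<close>

lemma lambda_max_ge:
  assumes N: "N \<in> carrier_mat n n" and sym: "transpose_mat N = N" and n: "0 < n"
    and Z: "Z \<in> carrier_mat n k"
  shows "mat_inner Z (N * Z) \<le> lambda_max N * mat_inner Z Z"
proof (cases "k = 0")
  case True
  then show ?thesis using Z by (simp add: mat_inner_def)
next
  case False
  have N': "- N \<in> carrier_mat n n" using N by simp
  have sym': "transpose_mat (- N) = - N" using sym by (simp add: transpose_uminus)
  obtain \<mu> where \<mu>: "eigenvalue (- N) \<mu>" "\<mu> * mat_inner Z Z \<le> mat_inner Z ((- N) * Z)"
    using symmetric_eigenvalue_lower_bound[OF N' sym' n, of k] False Z by blast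
  have "- \<mu> \<le> lambda_max N"
    unfolding lambda_max_def using eigenvalue_uminus[OF N \<mu>(1)]
    by (intro Max_ge finite_eigenvalues[OF N]) simp
  then have 1: "- \<mu> * mat_inner Z Z \<le> lambda_max N * mat_inner Z Z"
    by (intro mult_right_mono mat_inner_self_nonneg)
  have "(- N) * Z = - (N * Z)" using N Z by simp
  also have "mat_inner Z (- (N * Z)) = - mat_inner Z (N * Z)"
    using N Z by (auto simp: mat_inner_def sum_negf[symmetric] simp del: index_mult_mat(1) intro!: sum.cong)
  finally show ?thesis using \<mu>(2) 1 by simp
qed

lemma ex_eigenvalue_symmetric:
  fixes N :: "real mat"
  assumes "N \<in> carrier_mat n n" "transpose_mat N = N" "0 < n"
  shows "{e. eigenvalue N e} \<noteq> {}"
  using symmetric_eigenvalue_lower_bound[OF assms, where k = 1] by (auto simp del: One_nat_def)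

section \<open>The Moore-Penrose inverse\<close>

lemma mult_assoc_dim:
  fixes C :: "'a :: semiring_0 mat"
  shows "dim_col C = dim_row D \<Longrightarrow> dim_col D = dim_row E \<Longrightarrow> (C * D) * E = C * (D * E)"
  by (rule assoc_mult_mat[OF carrier_matI carrier_matI carrier_matI]) auto

lemma transpose_mult_dim:
  fixes C :: "'a :: comm_semiring_0 mat"
  shows "dim_col C = dim_row D \<Longrightarrow> transpose_mat (C * D) = transpose_mat D * transpose_mat C"
  by (rule transpose_mult[OF carrier_matI carrier_matI]) auto

lemma mult_minus_distrib_dim:
  fixes C :: "'a :: ring mat"
  shows "dim_col C = dim_row D \<Longrightarrow> dim_row E = dim_row D \<Longrightarrow> dim_col E = dim_col D \<Longrightarrow>
    C * (D - E) = C * D - C * E"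
  by (rule mult_minus_distrib_mat[OF carrier_matI carrier_matI carrier_matI]) auto

lemma minus_eq_0_mat_iff:
  fixes C :: "'a :: group_add mat"
  assumes "C \<in> carrier_mat r c" "D \<in> carrier_mat r c"
  shows "C - D = 0\<^sub>m r c \<longleftrightarrow> C = D"
proof
  assume *: "C - D = 0\<^sub>m r c"
  show "C = D"
  proof (rule eq_matI)
    fix i j assume "i < dim_row D" "j < dim_col D"
    then show "C $$ (i, j) = D $$ (i, j)"
      using arg_cong[OF *, of "\<lambda>M. M $$ (i, j)"] assms by auto
  qed (use assms in auto)
qed (use assms in auto)

text \<open>Row reduction writes \<open>A\<close> as \<open>Q * C\<close> with \<open>Q\<close>
  invertible and \<open>C\<close> in reduced echelon form. There the pivot columns are unit vectors,
  so selecting them inverts \<open>C\<close> on its nonzero rows, and \<open>P\<close>, the inverse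
  of \<open>Q\<close>, carries this back to \<open>A\<close>.\<close>

lemma ex_inner_inverse:
  fixes A :: "'a :: field mat"
  assumes A: "A \<in> carrier_mat m n"
  shows "\<exists>H\<in>carrier_mat n m. A * H * A = A"
proof -
  define C where "C = gauss_jordan_single A"
  note gj = gauss_jordan_single[OF A C_def[symmetric]]
  obtain P Q where PQ: "C = P * A" "P \<in> carrier_mat m m" "Q \<in> carrier_mat m m" "Q * P = 1\<^sub>m m"
    using gj(4) by auto
  have C: "C \<in> carrier_mat m n" by (rule gj(2))
  obtain f where "pivot_fun C f (dim_col C)" using gj(3) by (auto simp: row_echelon_form_def)
  then have f: "pivot_fun C f n" using C by simp
  have dC: "dim_row C = m" using C by simp
  note piv = pivot_funD[OF dC f]
  \<comment> \<open>Column \<open>i\<close> of \<open>H\<close> is the unit vector at the pivot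
    position of row \<open>i\<close>. A zero row has \<open>f i = n\<close>, which is out of range
    and leaves a zero column.\<close>
  define H where "H = mat n m (\<lambda>(j, i). if f i = j then 1 else 0 :: 'a)"
  have H: "H \<in> carrier_mat n m" by (simp add: H_def)
  define D where "D = mat m m (\<lambda>(a, i). if a = i \<and> f i < n then 1 else 0 :: 'a)"
  have CH: "C * H = D"
  proof (rule eq_matI)
    fix a i assume "a < dim_row D" "i < dim_col D"
    then have ai: "a < m" "i < m" by (auto simp: D_def)
    have "(C * H) $$ (a, i) = (if f i < n then C $$ (a, f i) else 0)"
      using C H ai
      by (auto simp: scalar_prod_def H_def if_distrib[where f = "\<lambda>x. c * x" for c] cong: if_cong)
    also have "\<dots> = D $$ (a, i)" using piv(4,5) ai by (auto simp: D_def)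
    finally show "(C * H) $$ (a, i) = D $$ (a, i)" .
  qed (use C H in \<open>auto simp: D_def\<close>)
  have DC: "D * C = C"
  proof (rule eq_matI)
    fix a j assume "a < dim_row C" "j < dim_col C"
    then have aj: "a < m" "j < n" using C by auto
    have "(D * C) $$ (a, j) = (\<Sum>l = 0..<m. (if a = l \<and> f l < n then 1 else 0) * C $$ (l, j))"
      using C aj by (auto simp: scalar_prod_def D_def intro!: sum.cong)
    also have "\<dots> = (\<Sum>l = 0..<m. if a = l then (if f l < n then C $$ (l, j) else 0) else 0)"
      by (intro sum.cong) auto
    also have "\<dots> = (if f a < n then C $$ (a, j) else 0)" using aj by (simp add: sum.delta)
    also have "\<dots> = C $$ (a, j)" using piv(1)[OF aj(1)] piv(2)[OF aj(1), of j] aj by auto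
    finally show "(D * C) $$ (a, j) = C $$ (a, j)" .
  qed (use C in \<open>auto simp: D_def\<close>)
  have "Q * C = (Q * P) * A" using PQ(2,3) A by (simp add: PQ(1) mult_assoc_dim)
  then have QC: "A = Q * C" using PQ(4) A by simp
  have "A * (H * P) * A = (A * H) * C" using A H PQ(2) by (simp add: PQ(1) mult_assoc_dim)
  also have "\<dots> = Q * ((C * H) * C)"
    using PQ(3) C H by (subst QC) (simp add: mult_assoc_dim)
  also have "\<dots> = A" by (simp add: CH DC QC[symmetric])
  finally have "A * (H * P) * A = A" .
  then show ?thesis using H PQ(2) by (intro bexI[of _ "H * P"]) auto
qed

text \<open>The squared norm of \<open>K\<close> is the trace of its Gram matrix, expressed here as
  an inner product with the identity.\<close>

lemma gram_mult_eq_0D: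
  fixes K :: "real mat"
  assumes K: "K \<in> carrier_mat r c" and 0: "transpose_mat K * K = 0\<^sub>m c c"
  shows "K = 0\<^sub>m r c"
proof -
  have "mat_inner K K = mat_inner (K * 1\<^sub>m c) K" using K by simp
  also have "\<dots> = mat_inner (1\<^sub>m c) (transpose_mat K * K)"
    by (rule mat_inner_mult_left[OF K one_carrier_mat K])
  also have "\<dots> = 0" unfolding 0 by (simp add: mat_inner_def)
  finally show ?thesis by (rule mat_inner_self_eq_0D[OF K])
qed

text \<open>Cancels the left factor \<open>transpose_mat C\<close>: the defect \<open>K\<close> is
  annihilated by it and also has the form \<open>C * L\<close>, so the Gram matrix of
  \<open>K\<close> vanishes.\<close>

lemma gram_inner_inverse:
  fixes C :: "real mat"
  assumes C: "C \<in> carrier_mat r c" and H: "H \<in> carrier_mat c c"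
    and eq: "transpose_mat C * C * H * (transpose_mat C * C) = transpose_mat C * C"
  shows "C * (H * (transpose_mat C * C)) = C"
proof -
  define L where "L = H * (transpose_mat C * C) - 1\<^sub>m c"
  define K where "K = C * (H * (transpose_mat C * C)) - C"
  have L: "L \<in> carrier_mat c c" by (simp add: L_def minus_carrier_mat)
  have K: "K \<in> carrier_mat r c" using C by (simp add: K_def minus_carrier_mat)
  have KL: "K = C * L" unfolding K_def L_def using C H by (simp add: mult_minus_distrib_dim)
  have "transpose_mat C * K = 0\<^sub>m c c"
    unfolding K_def using C H eq by (simp add: mult_minus_distrib_dim mult_assoc_dim)
  then have "transpose_mat K * K = transpose_mat L * 0\<^sub>m c c"
    using K L C by (subst KL) (simp add: transpose_mult_dim mult_assoc_dim)
  then have "transpose_mat K * K = 0\<^sub>m c c" using L by simp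
  then have "K = 0\<^sub>m r c" by (rule gram_mult_eq_0D[OF K])
  then show ?thesis unfolding K_def using C H by (subst (asm) minus_eq_0_mat_iff) auto
qed

text \<open>Inner inverses of the two Gram matrices give projections \<open>E1\<close> onto the
  column space and \<open>E2\<close> onto the row space. The matrix \<open>P\<close> has two
  expressions, one ending in \<open>E1\<close> and one starting with \<open>E2\<close>, and so
  satisfies \<open>C * P = E1\<close> and \<open>P * C = E2\<close>; the Penrose equations
  follow.\<close>

lemma ex_penrose_inverse: "\<exists>P. penrose_inverse C P"
proof -
  obtain r c where C: "C \<in> carrier_mat r c" by blast
  define D where "D = transpose_mat C"
  have D: "D \<in> carrier_mat c r" using C by (simp add: D_def)
  have DT: "transpose_mat D = C" "transpose_mat C = D" by (simp_all add: D_def)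
  note dims = carrier_matD[OF C] carrier_matD[OF D]
  obtain G where G: "G \<in> carrier_mat c c" "D * C * G * (D * C) = D * C"
    using ex_inner_inverse[of "D * C" c c] C D by auto
  obtain H where H: "H \<in> carrier_mat r r" "C * D * H * (C * D) = C * D"
    using ex_inner_inverse[of "C * D" r r] C D by auto
  have 1: "C * (G * (D * C)) = C"
    using gram_inner_inverse[OF C G(1)] G(2) by (simp add: DT)
  have 2: "D * (H * (C * D)) = D"
    using gram_inner_inverse[OF D H(1)] H(2) by (simp add: DT)
  note gdims = carrier_matD[OF G(1)] carrier_matD[OF H(1)]
  \<comment> \<open>the orthogonal projections onto the column space and the row space of \<open>C\<close>\<close>
  define E1 where "E1 = C * (G * D)"
  define E2 where "E2 = D * (H * C)"
  have E1: "E1 \<in> carrier_mat r r" and E2: "E2 \<in> carrier_mat c c"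
    using C D by (auto simp: E1_def E2_def)
  have E1C: "E1 * C = C" using 1 by (simp add: E1_def mult_assoc_dim dims gdims)
  have E2D: "E2 * D = D" using 2 by (simp add: E2_def mult_assoc_dim dims gdims)
  have E1T: "transpose_mat E1 = C * (transpose_mat G * D)"
    by (simp add: E1_def transpose_mult_dim mult_assoc_dim dims gdims DT)
  have E2T: "transpose_mat E2 = D * (transpose_mat H * C)"
    by (simp add: E2_def transpose_mult_dim mult_assoc_dim dims gdims DT)
  have DE1: "D * transpose_mat E1 = D"
    using arg_cong[OF E1C, of transpose_mat] by (simp add: transpose_mult_dim E1 carrier_matD[OF E1] dims DT)
  have CE2: "C * transpose_mat E2 = C"
    using arg_cong[OF E2D, of transpose_mat] by (simp add: transpose_mult_dim E2 carrier_matD[OF E2] dims DT)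
  \<comment> \<open>The inner inverse \<open>G\<close> need not be symmetric, so symmetry of
    \<open>E1\<close> comes from evaluating \<open>E1 * transpose_mat E1\<close> in two
    ways.\<close>
  have "E1 * transpose_mat E1 = transpose_mat E1"
    unfolding E1T using E1C by (simp add: mult_assoc_dim[symmetric] dims gdims carrier_matD[OF E1])
  moreover have "E1 * transpose_mat E1 = E1"
    unfolding E1_def using DE1 by (simp add: E1_def mult_assoc_dim dims gdims)
  ultimately have s1: "transpose_mat E1 = E1" by simp
  have "E2 * transpose_mat E2 = transpose_mat E2"
    unfolding E2T using E2D by (simp add: mult_assoc_dim[symmetric] dims gdims carrier_matD[OF E2])
  moreover have "E2 * transpose_mat E2 = E2"
    unfolding E2_def using CE2 by (simp add: E2_def mult_assoc_dim dims gdims)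
  ultimately have s2: "transpose_mat E2 = E2" by simp
  define P where "P = D * (H * E1)"
  have P: "P \<in> carrier_mat c r" using D E1 H(1) by (auto simp: P_def)
  have P': "P = E2 * (G * D)" by (simp add: P_def E1_def E2_def mult_assoc_dim dims gdims)
  have CP: "C * P = E1"
  proof -
    have "C * P = (C * E2) * (G * D)"
      unfolding P' using E2 by (simp add: mult_assoc_dim dims gdims)
    then show ?thesis using CE2 s2 by (simp add: E1_def)
  qed
  have PC: "P * C = E2"
  proof -
    have "P * C = D * (H * (E1 * C))"
      unfolding P_def using E1 by (simp add: mult_assoc_dim dims gdims)
    then show ?thesis by (simp add: E1C E2_def)
  qed
  have "P * C * P = P"
  proof -
    have "P * C * P = (E2 * D) * (H * E1)"
      unfolding PC using E1 E2 by (simp add: P_def mult_assoc_dim dims gdims)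
    then show ?thesis by (simp add: E2D P_def)
  qed
  then have "penrose_inverse C P"
    unfolding penrose_inverse_def using P C CP PC E1C s1 s2 by auto
  then show ?thesis ..
qed

text \<open>Symmetry of the products allows their factors to be exchanged under transposition, so
  \<open>P\<close> and \<open>Q\<close> have equal products with \<open>C\<close> on either side.
  Then \<open>P = P * C * P = Q * C * Q = Q\<close>.\<close>

lemma penrose_inverse_unique:
  assumes P: "penrose_inverse C P" and Q: "penrose_inverse C Q"
  shows "P = Q"
proof -
  note p = P[unfolded penrose_inverse_def] and q = Q[unfolded penrose_inverse_def]
  have d: "dim_row P = dim_col C" "dim_col P = dim_row C" "dim_row Q = dim_col C" "dim_col Q = dim_row C"
    using p q by auto
  have "C * P = C * Q"
  proof -
    have "C * P = transpose_mat (C * Q * C * P)" using p q by metis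
    also have "\<dots> = transpose_mat (C * P) * transpose_mat (C * Q)"
      by (simp add: mult_assoc_dim transpose_mult_dim d)
    also have "\<dots> = (C * P) * (C * Q)" using p q by simp
    also have "\<dots> = (C * P * C) * Q" by (simp add: mult_assoc_dim d)
    also have "\<dots> = C * Q" using p by simp
    finally show ?thesis .
  qed
  moreover have "P * C = Q * C"
  proof -
    have "P * C = transpose_mat (P * (C * Q * C))" using p q by metis
    also have "\<dots> = transpose_mat (Q * C) * transpose_mat (P * C)"
      by (simp add: mult_assoc_dim transpose_mult_dim d)
    also have "\<dots> = (Q * C) * (P * C)" using p q by simp
    also have "\<dots> = Q * (C * P * C)" by (simp add: mult_assoc_dim d)
    also have "\<dots> = Q * C" using p by simp
    finally show ?thesis .
  qed
  ultimately show ?thesis using p q d by (metis mult_assoc_dim)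
qed

lemma penrose_inverse_pinv: "penrose_inverse C (pinv C)"
  unfolding pinv_def using ex_penrose_inverse penrose_inverse_unique by (metis theI)

lemma pinv_eqI: "penrose_inverse C P \<Longrightarrow> pinv C = P"
  using penrose_inverse_unique penrose_inverse_pinv by blast

lemma
  shows dim_row_pinv: "dim_row (pinv C) = dim_col C"
    and dim_col_pinv: "dim_col (pinv C) = dim_row C"
    and mult_pinv_mult: "C * (pinv C * C) = C"
    and pinv_mult_pinv: "pinv C * (C * pinv C) = pinv C"
    and symmetric_mult_pinv: "transpose_mat (C * pinv C) = C * pinv C"
    and symmetric_pinv_mult: "transpose_mat (pinv C * C) = pinv C * C"
proof -
  note p = penrose_inverse_pinv[of C, unfolded penrose_inverse_def]
  show d: "dim_row (pinv C) = dim_col C" "dim_col (pinv C) = dim_row C" using p by auto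
  show "C * (pinv C * C) = C" "pinv C * (C * pinv C) = pinv C"
    using p d by (metis mult_assoc_dim)+
  show "transpose_mat (C * pinv C) = C * pinv C" "transpose_mat (pinv C * C) = pinv C * C"
    using p by auto
qed

lemma pinv_transpose: "pinv (transpose_mat C) = transpose_mat (pinv C)"
proof (rule pinv_eqI)
  note p = penrose_inverse_pinv[of C, unfolded penrose_inverse_def]
  note d = dim_row_pinv[of C] dim_col_pinv[of C]
  have "transpose_mat C * transpose_mat (pinv C) = pinv C * C"
    "transpose_mat (pinv C) * transpose_mat C = C * pinv C"
    using p d by (metis transpose_mult_dim)+
  moreover have "transpose_mat C * transpose_mat (pinv C) * transpose_mat C = transpose_mat (C * pinv C * C)"
    "transpose_mat (pinv C) * transpose_mat C * transpose_mat (pinv C) = transpose_mat (pinv C * C * pinv C)"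
    by (simp_all add: transpose_mult_dim mult_assoc_dim d)
  ultimately show "penrose_inverse (transpose_mat C) (transpose_mat (pinv C))"
    unfolding penrose_inverse_def using p d by simp
qed

text \<open>Exhibits the columns of the pseudoinverse as elements of the row space of
  \<open>C\<close>. This is the reason why pseudoinverse corrections keep the errors in the required
  ranges.\<close>

lemma pinv_eq_transpose_mult: "pinv C = transpose_mat C * (transpose_mat (pinv C) * pinv C)"
proof -
  note d = dim_row_pinv[of C] dim_col_pinv[of C]
  have "pinv C = transpose_mat (pinv C * C) * pinv C"
    using pinv_mult_pinv[of C] symmetric_pinv_mult[of C] d by (simp add: mult_assoc_dim)
  then show ?thesis by (simp add: transpose_mult_dim mult_assoc_dim d)
qed

section \<open>Singular values\<close>

lemma mat_inner_mult_transpose_self: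
  assumes N: "N \<in> carrier_mat r c" and Z: "Z \<in> carrier_mat r k"
  shows "mat_inner Z (N * transpose_mat N * Z) = mat_inner (transpose_mat N * Z) (transpose_mat N * Z)"
proof -
  have NZ: "transpose_mat N * Z \<in> carrier_mat c k" using N Z by simp
  have "mat_inner (N * (transpose_mat N * Z)) Z = mat_inner (transpose_mat N * Z) (transpose_mat N * Z)"
    by (rule mat_inner_mult_left[OF N NZ Z])
  moreover have "N * transpose_mat N * Z = N * (transpose_mat N * Z)"
    using N Z by (simp add: mult_assoc_dim)
  moreover have "N * (transpose_mat N * Z) \<in> carrier_mat r k" using N NZ by simp
  ultimately show ?thesis using mat_inner_commute[OF Z] by simp
qed

text \<open>The squared norm of \<open>transpose_mat N * Z\<close> equals the inner product of
  \<open>Z\<close> with \<open>N * Y\<close>. The resulting inequality transfers both upper and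
  lower bounds from one of \<open>N\<close> and its transpose to the other.\<close>

lemma gram_Cauchy_Schwarz:
  assumes N: "N \<in> carrier_mat r c" and Z: "Z \<in> carrier_mat r k"
  defines "Y \<equiv> transpose_mat N * Z"
  shows "(mat_inner Y Y)\<^sup>2 \<le> mat_inner Z Z * mat_inner (N * Y) (N * Y)"
proof -
  have Y: "Y \<in> carrier_mat c k" using N Z by (simp add: Y_def)
  have NY: "N * Y \<in> carrier_mat r k" using N Y by simp
  have "mat_inner Y Y = mat_inner Z (N * Y)"
    using mat_inner_mult_transpose_self[OF N Z] N Z by (simp add: Y_def mult_assoc_dim)
  then show ?thesis using mat_inner_Cauchy_Schwarz[OF Z NY] by simp
qed

text \<open>A matrix and its transpose have the same operator norm: the preceding inequality and the
  bound at \<open>Y\<close> leave a common factor \<open>mat_inner Y Y\<close>, which cancels unless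
  it is 0.\<close>

lemma mult_upper_bound_transpose:
  assumes N: "N \<in> carrier_mat r c" and \<beta>: "0 \<le> \<beta>"
    and le: "\<And>W. W \<in> carrier_mat c k \<Longrightarrow> mat_inner (N * W) (N * W) \<le> \<beta> * mat_inner W W"
    and Z: "Z \<in> carrier_mat r k"
  shows "mat_inner (transpose_mat N * Z) (transpose_mat N * Z) \<le> \<beta> * mat_inner Z Z"
proof -
  define Y where "Y = transpose_mat N * Z"
  have Y: "Y \<in> carrier_mat c k" using N Z by (simp add: Y_def)
  have "(mat_inner Y Y)\<^sup>2 \<le> mat_inner Z Z * mat_inner (N * Y) (N * Y)"
    unfolding Y_def by (rule gram_Cauchy_Schwarz[OF N Z])
  also have "\<dots> \<le> mat_inner Z Z * (\<beta> * mat_inner Y Y)"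
    by (intro mult_left_mono le Y mat_inner_self_nonneg)
  finally have "mat_inner Y Y * mat_inner Y Y \<le> (\<beta> * mat_inner Z Z) * mat_inner Y Y"
    by (simp add: power2_eq_square algebra_simps)
  then show ?thesis
    using mat_inner_self_nonneg[of Y] mat_inner_self_nonneg[of Z] \<beta> unfolding Y_def[symmetric]
    by (cases "mat_inner Y Y = 0") (auto simp: mult_le_cancel_right)
qed

text \<open>A lower bound for the transpose at \<open>Z\<close> becomes one for \<open>N\<close> at
  \<open>transpose_mat N * Z\<close>. \<open>N\<close> may have a kernel; the conclusion concerns
  only the range of its transpose.\<close>

lemma mult_lower_bound_transpose:
  assumes N: "N \<in> carrier_mat r c" and \<alpha>: "0 \<le> \<alpha>" and Z: "Z \<in> carrier_mat r k"
    and le: "\<alpha> * mat_inner Z Z \<le> mat_inner (transpose_mat N * Z) (transpose_mat N * Z)"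
  shows "\<alpha> * mat_inner (transpose_mat N * Z) (transpose_mat N * Z)
    \<le> mat_inner (N * (transpose_mat N * Z)) (N * (transpose_mat N * Z))"
proof -
  define Y where "Y = transpose_mat N * Z"
  have "\<alpha> * (mat_inner Y Y)\<^sup>2 \<le> \<alpha> * (mat_inner Z Z * mat_inner (N * Y) (N * Y))"
    unfolding Y_def by (intro mult_left_mono gram_Cauchy_Schwarz[OF N Z] \<alpha>)
  also have "\<dots> = (\<alpha> * mat_inner Z Z) * mat_inner (N * Y) (N * Y)" by simp
  also have "\<dots> \<le> mat_inner Y Y * mat_inner (N * Y) (N * Y)"
    using le unfolding Y_def by (intro mult_right_mono mat_inner_self_nonneg)
  finally have "(\<alpha> * mat_inner Y Y) * mat_inner Y Y \<le> mat_inner (N * Y) (N * Y) * mat_inner Y Y"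
    by (simp add: power2_eq_square algebra_simps)
  then show ?thesis
    using mat_inner_self_nonneg[of Y] mat_inner_self_nonneg[of "N * Y"] unfolding Y_def[symmetric]
    by (cases "mat_inner Y Y = 0") (auto simp: mult_le_cancel_right)
qed

lemma symmetric_gram: "transpose_mat (N * transpose_mat N) = N * transpose_mat (N :: real mat)"
  by (simp add: transpose_mult_dim)

lemma lambda_max_gram_ge:
  assumes N: "N \<in> carrier_mat r c" and r: "0 < r" and Z: "Z \<in> carrier_mat r k"
  shows "mat_inner (transpose_mat N * Z) (transpose_mat N * Z)
    \<le> lambda_max (N * transpose_mat N) * mat_inner Z Z"
  using lambda_max_ge[OF _ symmetric_gram[of N] r Z] mat_inner_mult_transpose_self[OF N Z] N by simp

lemma lambda_min_gram_le:
  assumes N: "N \<in> carrier_mat r c" and r: "0 < r" and Z: "Z \<in> carrier_mat r k"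
  shows "lambda_min (N * transpose_mat N) * mat_inner Z Z
    \<le> mat_inner (transpose_mat N * Z) (transpose_mat N * Z)"
  using lambda_min_le[OF _ symmetric_gram[of N] r Z] mat_inner_mult_transpose_self[OF N Z] N by simp

lemma eigenvalue_gram_nonneg:
  fixes N :: "real mat"
  assumes N: "N \<in> carrier_mat r c" and e: "eigenvalue (N * transpose_mat N) e"
  shows "0 \<le> e"
proof -
  define G where "G = N * transpose_mat N"
  have G: "G \<in> carrier_mat r r" using N by (simp add: G_def)
  obtain v where v: "v \<in> carrier_vec r" "v \<noteq> 0\<^sub>v r" "G *\<^sub>v v = e \<cdot>\<^sub>v v"
    using e G by (auto simp: eigenvalue_def eigenvector_def simp flip: G_def)
  \<comment> \<open>The eigenvector is recast as a one-column matrix so that the Frobenius inner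
    product applies to it.\<close>
  define Z where "Z = mat r 1 (\<lambda>(i, _). v $ i)"
  have Z: "Z \<in> carrier_mat r 1" by (simp add: Z_def)
  have colZ: "col Z 0 = v" using v(1) by (intro eq_vecI) (auto simp: Z_def)
  have GZ: "G * Z = e \<cdot>\<^sub>m Z"
  proof (rule eq_matI)
    fix i j assume "i < dim_row (e \<cdot>\<^sub>m Z)" "j < dim_col (e \<cdot>\<^sub>m Z)"
    then have ij: "i < r" "j = 0" by (auto simp: Z_def)
    have "(G * Z) $$ (i, j) = (G *\<^sub>v col Z 0) $ i"
      using ij G Z by auto
    also have "\<dots> = e * v $ i" unfolding colZ v(3) using v(1) ij by simp
    finally show "(G * Z) $$ (i, j) = (e \<cdot>\<^sub>m Z) $$ (i, j)" using ij by (simp add: Z_def)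
  qed (use G Z in auto)
  then have "e * mat_inner Z Z = mat_inner (transpose_mat N * Z) (transpose_mat N * Z)"
    using mat_inner_mult_transpose_self[OF N Z] mat_inner_smult_right[OF Z Z]
    by (simp add: GZ flip: G_def)
  then have "0 \<le> e * mat_inner Z Z" by (simp add: mat_inner_self_nonneg)
  moreover have "mat_inner Z Z \<noteq> 0"
  proof
    assume "mat_inner Z Z = 0"
    then have "Z = 0\<^sub>m r 1" by (rule mat_inner_self_eq_0D[OF Z])
    then have "col Z 0 = 0\<^sub>v r" by simp
    then show False using colZ v(2) by simp
  qed
  ultimately show ?thesis using mat_inner_self_nonneg[of Z] by (simp add: zero_le_mult_iff)
qed

section \<open>Singular values as bounds on the row and column spaces\<close>

definition small_gram :: "real mat \<Rightarrow> real mat" where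
  "small_gram C = (if dim_row C \<le> dim_col C then C * transpose_mat C else transpose_mat C * C)"

text \<open>The monotone square root commutes with minimum and maximum over the finite nonempty
  spectrum, and squaring undoes it because Gram matrices have nonnegative eigenvalues.\<close>

lemma
  assumes C: "C \<in> carrier_mat r c" and dims: "0 < r" "0 < c"
  shows sigma_min_power2: "(sigma_min C)\<^sup>2 = lambda_min (small_gram C)"
    and sigma_max_power2: "(sigma_max C)\<^sup>2 = lambda_max (small_gram C)"
    and lambda_min_small_gram_nonneg: "0 \<le> lambda_min (small_gram C)"
proof -
  \<comment> \<open>Writing either Gram matrix as \<open>N * transpose_mat N\<close> makes one
    argument serve both shapes.\<close>
  obtain N l where N: "N \<in> carrier_mat (min r c) l" "small_gram C = N * transpose_mat N"
    using C by (cases "r \<le> c") (auto simp: small_gram_def min_def intro: that[of C] that[of "transpose_mat C"])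
  have G: "small_gram C \<in> carrier_mat (min r c) (min r c)" using N by simp
  define S where "S = {e. eigenvalue (small_gram C) e}"
  have fin: "finite S" unfolding S_def by (rule finite_eigenvalues[OF G])
  have ne: "S \<noteq> {}" unfolding S_def
    using dims by (intro ex_eigenvalue_symmetric[OF G]) (auto simp: N(2) symmetric_gram)
  have nonneg: "\<And>e. e \<in> S \<Longrightarrow> 0 \<le> e" using eigenvalue_gram_nonneg[OF N(1)] by (auto simp: S_def N(2))
  have sv: "singular_values C = sqrt ` S" by (simp add: singular_values_def S_def small_gram_def)
  have mono: "mono sqrt" by (auto intro: monoI)
  show min: "0 \<le> lambda_min (small_gram C)"
    using Min_in[OF fin ne] nonneg by (auto simp: lambda_min_def S_def)
  have max: "0 \<le> lambda_max (small_gram C)"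
    using Max_in[OF fin ne] nonneg by (auto simp: lambda_max_def S_def)
  show "(sigma_min C)\<^sup>2 = lambda_min (small_gram C)"
    using mono_Min_commute[OF mono fin ne, symmetric] min
    by (simp add: sigma_min_def sv lambda_min_def S_def flip: S_def)
  show "(sigma_max C)\<^sup>2 = lambda_max (small_gram C)"
    using mono_Max_commute[OF mono fin ne, symmetric] max
    by (simp add: sigma_max_def sv lambda_max_def S_def flip: S_def)
qed

text \<open>If \<open>C\<close> is tall, the smaller Gram matrix bounds \<open>C\<close> below
  everywhere. If it is wide, that matrix bounds the transpose below, and the bound passes to
  \<open>C\<close> on the row space.\<close>

lemma sigma_min_le_transpose:
  assumes C: "C \<in> carrier_mat r c" and dims: "0 < r" "0 < c" and Z: "Z \<in> carrier_mat r k"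
  shows "(sigma_min C)\<^sup>2 * mat_inner (transpose_mat C * Z) (transpose_mat C * Z)
    \<le> mat_inner (C * (transpose_mat C * Z)) (C * (transpose_mat C * Z))"
proof (cases "r \<le> c")
  case True
  then have "small_gram C = C * transpose_mat C" using C by (simp add: small_gram_def)
  then show ?thesis
    using mult_lower_bound_transpose[OF C _ Z lambda_min_gram_le[OF C dims(1) Z]]
      lambda_min_small_gram_nonneg[OF C dims] by (simp add: sigma_min_power2[OF C dims])
next
  case False
  then have "small_gram C = transpose_mat C * C" using C by (simp add: small_gram_def)
  then show ?thesis
    using lambda_min_gram_le[of "transpose_mat C" c r "transpose_mat C * Z" k] C Z dims
    by (simp add: sigma_min_power2[OF C dims])
qed

lemma sigma_min_le:
  assumes C: "C \<in> carrier_mat r c" and dims: "0 < r" "0 < c" and W: "W \<in> carrier_mat c k"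
  shows "(sigma_min C)\<^sup>2 * mat_inner (C * W) (C * W)
    \<le> mat_inner (transpose_mat C * (C * W)) (transpose_mat C * (C * W))"
proof (cases "r \<le> c")
  case True
  then have "small_gram C = C * transpose_mat C" using C by (simp add: small_gram_def)
  then show ?thesis
    using lambda_min_gram_le[of C r c "C * W" k] C W dims
    by (simp add: sigma_min_power2[OF C dims])
next
  case False
  have C': "transpose_mat C \<in> carrier_mat c r" using C by simp
  have "small_gram C = transpose_mat C * C" using C False by (simp add: small_gram_def)
  then show ?thesis
    using mult_lower_bound_transpose[OF C' _ W lambda_min_gram_le[OF C' dims(2) W]]
      lambda_min_small_gram_nonneg[OF C dims] by (simp add: sigma_min_power2[OF C dims])
qed

lemma sigma_max_ge_transpose:
  assumes C: "C \<in> carrier_mat r c" and dims: "0 < r" "0 < c" and Z: "Z \<in> carrier_mat r k"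
  shows "mat_inner (transpose_mat C * Z) (transpose_mat C * Z) \<le> (sigma_max C)\<^sup>2 * mat_inner Z Z"
proof (cases "r \<le> c")
  case True
  then have "small_gram C = C * transpose_mat C" using C by (simp add: small_gram_def)
  then show ?thesis
    using lambda_max_gram_ge[OF C dims(1) Z] by (simp add: sigma_max_power2[OF C dims])
next
  case False
  have C': "transpose_mat C \<in> carrier_mat c r" using C by simp
  have "small_gram C = transpose_mat C * C" using C False by (simp add: small_gram_def)
  then have "mat_inner (C * W) (C * W) \<le> (sigma_max C)\<^sup>2 * mat_inner W W" if "W \<in> carrier_mat c k" for W
    using lambda_max_gram_ge[OF C' dims(2) that] by (simp add: sigma_max_power2[OF C dims])
  then show ?thesis by (rule mult_upper_bound_transpose[OF C zero_le_power2 _ Z])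
qed

lemma pinv_mult_transpose: "pinv C * (C * transpose_mat C) = transpose_mat C"
proof -
  note d = dim_row_pinv[of C] dim_col_pinv[of C]
  have "transpose_mat (C * (pinv C * C)) = transpose_mat (pinv C * C) * transpose_mat C"
    by (rule transpose_mult_dim) (simp add: d)
  then show ?thesis by (simp add: mult_pinv_mult symmetric_pinv_mult mult_assoc_dim d)
qed

text \<open>On the row space \<open>pinv C * C\<close> is the identity, so submultiplicativity
  bounds such a matrix by its image under \<open>C\<close>. The constant remains usable when
  \<open>sigma_min C\<close> is 0.\<close>

lemma pinv_bound_transpose:
  assumes C: "C \<in> carrier_mat r c" and Z: "Z \<in> carrier_mat r k"
  shows "mat_inner (transpose_mat C * Z) (transpose_mat C * Z)
    \<le> mat_inner (pinv C) (pinv C) * mat_inner (C * (transpose_mat C * Z)) (C * (transpose_mat C * Z))"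
proof -
  have P: "pinv C \<in> carrier_mat c r" using C dim_row_pinv[of C] dim_col_pinv[of C] by auto
  have W: "C * (transpose_mat C * Z) \<in> carrier_mat r k" using C Z by simp
  have "pinv C * (C * transpose_mat C) * Z = pinv C * (C * (transpose_mat C * Z))"
    using C P Z by (simp add: mult_assoc_dim)
  then have "transpose_mat C * Z = pinv C * (C * (transpose_mat C * Z))"
    by (simp add: pinv_mult_transpose)
  then show ?thesis using mat_inner_mult_le[OF P W] by simp
qed

section \<open>Row blocks\<close>

text \<open>Converts sums over row positions of a submatrix into sums over the original row
  indices.\<close>

lemma bij_betw_pick:
  "bij_betw (pick I) {..<card {a. a < m \<and> a \<in> I}} {a. a < m \<and> a \<in> I}"
proof -
  let ?J = "{a. a < m \<and> a \<in> I}"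
  have eq: "pick I a = pick ?J a" if "a < card ?J" for a by (rule pick_reduce_set[OF that])
  have "inj_on (pick ?J) {..<card ?J}"
  proof (rule linorder_inj_onI')
    fix a b assume "b \<in> {..<card ?J}" "a < b"
    then have "pick ?J a < pick ?J b" by (intro pick_mono_le) auto
    then show "pick ?J a \<noteq> pick ?J b" by simp
  qed
  moreover have "pick ?J ` {..<card ?J} \<subseteq> ?J" using pick_in_set_le by blast
  ultimately have "bij_betw (pick ?J) {..<card ?J} ?J"
    unfolding bij_betw_def by (intro conjI card_subset_eq) (simp_all add: card_image)
  then show ?thesis using eq by (subst bij_betw_cong[of _ _ "pick ?J"]) auto
qed

lemma dim_rows_of:
  "dim_row (rows_of C I) = card {a. a < dim_row C \<and> a \<in> I}" "dim_col (rows_of C I) = dim_col C"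
  by (simp_all add: rows_of_def dim_submatrix)

lemma index_rows_of:
  "i < card {a. a < dim_row C \<and> a \<in> I} \<Longrightarrow> j < dim_col C \<Longrightarrow>
    rows_of C I $$ (i, j) = C $$ (pick I i, j)"
  unfolding rows_of_def by (subst submatrix_index) (auto simp: pick_UNIV)

text \<open>Reduces column blocks to row blocks of the transpose, so that one analysis covers both
  kinds of step.\<close>

lemma cols_of_eq: "cols_of C I = transpose_mat (rows_of (transpose_mat C) I)"
proof (rule eq_matI)
  fix i j assume "i < dim_row (transpose_mat (rows_of (transpose_mat C) I))"
    "j < dim_col (transpose_mat (rows_of (transpose_mat C) I))"
  then have ij: "i < dim_row C" "j < card {a. a < dim_col C \<and> a \<in> I}" by (auto simp: dim_rows_of)
  then have "pick I j < dim_col C" by (intro pick_le)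
  then show "cols_of C I $$ (i, j) = transpose_mat (rows_of (transpose_mat C) I) $$ (i, j)"
    using ij unfolding cols_of_def
    by (subst submatrix_index) (auto simp: pick_UNIV index_rows_of dim_rows_of)
qed (auto simp: cols_of_def dim_submatrix dim_rows_of)

lemma rows_of_mult:
  assumes "dim_col C = dim_row D"
  shows "rows_of (C * D) I = rows_of C I * D"
proof (rule eq_matI)
  fix i j assume "i < dim_row (rows_of C I * D)" "j < dim_col (rows_of C I * D)"
  then have ij: "i < card {a. a < dim_row C \<and> a \<in> I}" "j < dim_col D" by (auto simp: dim_rows_of)
  have *: "pick I i < dim_row C" by (rule pick_le[OF ij(1)])
  have "row (rows_of C I) i = row C (pick I i)"
    using ij by (intro eq_vecI) (auto simp: dim_rows_of index_rows_of *)
  then show "rows_of (C * D) I $$ (i, j) = (rows_of C I * D) $$ (i, j)"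
    using ij * by (simp add: index_rows_of dim_rows_of)
qed (auto simp: dim_rows_of)

lemma rows_of_minus:
  assumes "dim_row C = dim_row D" "dim_col C = dim_col D"
  shows "rows_of (C - D) I = rows_of C I - rows_of D I"
proof (rule eq_matI)
  fix i j assume "i < dim_row (rows_of C I - rows_of D I)" "j < dim_col (rows_of C I - rows_of D I)"
  then have ij: "i < card {a. a < dim_row D \<and> a \<in> I}" "j < dim_col D" by (auto simp: dim_rows_of)
  then show "rows_of (C - D) I $$ (i, j) = (rows_of C I - rows_of D I) $$ (i, j)"
    using pick_le[OF ij(1)] assms by (simp add: index_rows_of dim_rows_of)
qed (use assms in \<open>auto simp: dim_rows_of\<close>)

lemma rows_of_eq_mult: "rows_of C I = rows_of (1\<^sub>m (dim_row C)) I * C" for C :: "real mat"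
  using rows_of_mult[of "1\<^sub>m (dim_row C)" C I] left_mult_one_mat[OF carrier_matI[OF refl refl], of C] by simp

lemma mat_inner_rows_of:
  "mat_inner (rows_of C I) (rows_of C I)
    = (\<Sum>i | i < dim_row C \<and> i \<in> I. \<Sum>j<dim_col C. (C $$ (i, j))\<^sup>2)"
proof -
  have "mat_inner (rows_of C I) (rows_of C I)
      = (\<Sum>i<card {a. a < dim_row C \<and> a \<in> I}. \<Sum>j<dim_col C. (C $$ (pick I i, j))\<^sup>2)"
    unfolding mat_inner_def by (auto simp: dim_rows_of index_rows_of power2_eq_square intro!: sum.cong)
  also have "\<dots> = (\<Sum>i | i < dim_row C \<and> i \<in> I. \<Sum>j<dim_col C. (C $$ (i, j))\<^sup>2)"
    by (rule sum.reindex_bij_betw[OF bij_betw_pick])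
  finally show ?thesis .
qed

section \<open>Blocks of a partition: exhaustion and nonemptiness\<close>

lemma sum_consecutive_blocks:
  fixes g :: "nat \<Rightarrow> 'a :: comm_monoid_add"
  shows "(\<Sum>b<r. \<Sum>k = b * m div s..<(b + 1) * m div s. g k) = (\<Sum>k<r * m div s. g k)"
proof (induction r)
  case (Suc r)
  have "r * m div s \<le> Suc r * m div s" by (intro div_le_mono) simp
  then show ?case
    using Suc sum.atLeastLessThan_concat[of 0 "r * m div s" "Suc r * m div s" g]
    by (simp add: lessThan_atLeast0)
qed simp

lemma part_block_subset:
  assumes "\<pi> permutes {..<m}" "b < s"
  shows "part_block \<pi> m s b \<subseteq> {..<m}"
proof -
  have "(b + 1) * m \<le> s * m" using assms(2) by (intro mult_le_mono1) simp
  from div_le_mono[OF this, of s] have "(b + 1) * m div s \<le> m" using assms(2) by simp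
  then have "{b * m div s..<(b + 1) * m div s} \<subseteq> {..<m}" by auto
  then show ?thesis unfolding part_block_def using permutes_image[OF assms(1)] by blast
qed

lemma sum_part_block:
  fixes g :: "nat \<Rightarrow> 'a :: comm_monoid_add"
  assumes \<pi>: "\<pi> permutes {..<m}" and s: "0 < s"
  shows "(\<Sum>b<s. \<Sum>i\<in>part_block \<pi> m s b. g i) = (\<Sum>i<m. g i)"
proof -
  have inj: "inj_on \<pi> K" for K using permutes_inj_on[OF \<pi>] .
  have "(\<Sum>b<s. \<Sum>i\<in>part_block \<pi> m s b. g i)
      = (\<Sum>b<s. \<Sum>k = b * m div s..<(b + 1) * m div s. g (\<pi> k))"
    unfolding part_block_def by (simp add: sum.reindex[OF inj])
  also have "\<dots> = (\<Sum>k<m. g (\<pi> k))" unfolding sum_consecutive_blocks using s by simp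
  also have "\<dots> = (\<Sum>i<m. g i)" by (rule sum.permute[OF \<pi>, unfolded comp_def, symmetric])
  finally show ?thesis .
qed

lemma sum_mat_inner_rows_of_part_block:
  assumes C: "C \<in> carrier_mat m c" and \<pi>: "\<pi> permutes {..<m}" and s: "0 < s"
  shows "(\<Sum>b<s. mat_inner (rows_of C (part_block \<pi> m s b)) (rows_of C (part_block \<pi> m s b)))
    = mat_inner C C"
proof -
  have "{i. i < m \<and> i \<in> part_block \<pi> m s b} = part_block \<pi> m s b" if "b < s" for b
    using part_block_subset[OF \<pi> that] by auto
  then have "(\<Sum>b<s. mat_inner (rows_of C (part_block \<pi> m s b)) (rows_of C (part_block \<pi> m s b)))
      = (\<Sum>b<s. \<Sum>i\<in>part_block \<pi> m s b. \<Sum>j<c. (C $$ (i, j))\<^sup>2)"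
    using C by (simp add: mat_inner_rows_of)
  also have "\<dots> = mat_inner C C"
    by (simp add: sum_part_block[OF \<pi> s] mat_inner_carrier[OF C] power2_eq_square)
  finally show ?thesis .
qed

text \<open>The extreme eigenvalues of a block Gram matrix are meaningful only for a nonempty block.
  As \<open>s \<le> m\<close>, adding \<open>m\<close> to the numerator raises the rounded quotient
  by at least one.\<close>

lemma dim_row_rows_of_part_block_pos:
  assumes C: "C \<in> carrier_mat m c" and \<pi>: "\<pi> permutes {..<m}" and s: "0 < s" "s \<le> m" and b: "b < s"
  shows "0 < dim_row (rows_of C (part_block \<pi> m s b))"
proof -
  have "b * m div s + 1 = (b * m + s) div s" using s(1) by simp
  also have "\<dots> \<le> (b + 1) * m div s" using s by (intro div_le_mono) simp
  finally have "b * m div s < (b + 1) * m div s" by simp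
  then have "\<pi> (b * m div s) \<in> part_block \<pi> m s b" unfolding part_block_def by auto
  then have "{a. a < m \<and> a \<in> part_block \<pi> m s b} \<noteq> {}"
    using part_block_subset[OF \<pi> b] by auto
  then show ?thesis using C by (simp add: dim_rows_of card_gt_0_iff)
qed

section \<open>One block step\<close>

lemma pinv_carrier: "R \<in> carrier_mat r n \<Longrightarrow> pinv R \<in> carrier_mat n r"
  using dim_row_pinv[of R] dim_col_pinv[of R] by auto

lemma pinv_mult_absorb:
  assumes R: "R \<in> carrier_mat r n" and W: "W \<in> carrier_mat r k"
  shows "pinv R * (R * (pinv R * W)) = pinv R * W"
proof -
  have "pinv R * (R * pinv R) * W = pinv R * (R * (pinv R * W))"
    using R W pinv_carrier[OF R] by (simp add: mult_assoc_dim)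
  then show ?thesis by (simp add: pinv_mult_pinv)
qed

lemma mat_inner_pinv_mult:
  assumes R: "R \<in> carrier_mat r n" and E: "E \<in> carrier_mat n k" and D: "D \<in> carrier_mat n k"
  shows "mat_inner (pinv R * (R * E)) D = mat_inner E (pinv R * (R * D))"
proof -
  have PR: "pinv R * R \<in> carrier_mat n n" using R pinv_carrier[OF R] by simp
  have "mat_inner (pinv R * R * E) D = mat_inner E (transpose_mat (pinv R * R) * D)"
    by (rule mat_inner_mult_left[OF PR E D])
  then show ?thesis
    using R E D pinv_carrier[OF R] by (simp add: symmetric_pinv_mult mult_assoc_dim)
qed

text \<open>Pythagoras: \<open>pinv R * R\<close> is symmetric and idempotent, hence
  \<open>H\<close> is the orthogonal projection of \<open>E\<close> onto the row space of
  \<open>R\<close>.\<close>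

lemma mat_inner_residual:
  assumes R: "R \<in> carrier_mat r n" and E: "E \<in> carrier_mat n k"
  defines "H \<equiv> pinv R * (R * E)"
  shows "mat_inner (E - H) (E - H) = mat_inner E E - mat_inner H H"
proof -
  have H: "H \<in> carrier_mat n k" using R E pinv_carrier[OF R] by (auto simp: H_def)
  have "pinv R * (R * H) = H"
    unfolding H_def using pinv_mult_absorb[OF R, of "R * E" k] R E by auto
  then have "mat_inner H H = mat_inner E H"
    using mat_inner_pinv_mult[OF R E H] by (simp add: H_def)
  then show ?thesis
    using E H mat_inner_commute[OF E H]
    by (simp add: minus_carrier_mat mat_inner_minus_left[where r = n and c = k]
        mat_inner_minus_right[where r = n and c = k])
qed

text \<open>The removed part \<open>H\<close> has the same image under \<open>R\<close> as
  \<open>E\<close>, so the upper bound for \<open>R\<close> at \<open>H\<close> bounds the norm of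
  \<open>H\<close> from below.\<close>

lemma mat_inner_residual_le:
  assumes R: "R \<in> carrier_mat r n" and E: "E \<in> carrier_mat n k" and \<beta>: "0 < \<beta>"
    and le: "\<And>W. W \<in> carrier_mat n k \<Longrightarrow> mat_inner (R * W) (R * W) \<le> \<beta> * mat_inner W W"
  shows "mat_inner (E - pinv R * (R * E)) (E - pinv R * (R * E))
    \<le> mat_inner E E - mat_inner (R * E) (R * E) / \<beta>"
proof -
  define H where "H = pinv R * (R * E)"
  have H: "H \<in> carrier_mat n k" using R E pinv_carrier[OF R] by (auto simp: H_def)
  have "R * (pinv R * R) * E = R * H"
    using R E pinv_carrier[OF R] by (simp add: mult_assoc_dim H_def)
  then have "R * E = R * H" by (simp add: mult_pinv_mult)
  then have "mat_inner (R * E) (R * E) \<le> \<beta> * mat_inner H H" using le[OF H] by simp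
  then have "mat_inner (R * E) (R * E) / \<beta> \<le> mat_inner H H" using \<beta> by (simp add: field_simps)
  then show ?thesis using mat_inner_residual[OF R E] by (simp add: H_def)
qed

text \<open>The symmetric projection \<open>pinv R * R\<close> annihilates the residual and fixes
  \<open>pinv R * W\<close>, so the two are orthogonal.\<close>

lemma mat_inner_residual_add:
  assumes R: "R \<in> carrier_mat r n" and E: "E \<in> carrier_mat n k" and W: "W \<in> carrier_mat r k"
  defines "D \<equiv> E - pinv R * (R * E)"
  shows "mat_inner (D + pinv R * W) (D + pinv R * W)
    = mat_inner D D + mat_inner (pinv R * W) (pinv R * W)"
proof -
  note P = pinv_carrier[OF R]
  define H where "H = pinv R * W"
  have H: "H \<in> carrier_mat n k" using P W by (simp add: H_def)
  have RE: "R * E \<in> carrier_mat r k" using R E by simp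
  have D: "D \<in> carrier_mat n k" using P RE by (auto simp: D_def intro!: minus_carrier_mat)
  have "R * D = R * E - R * (pinv R * (R * E))"
    unfolding D_def using R E P by (simp add: mult_minus_distrib_dim)
  then have "pinv R * (R * D) = pinv R * (R * E) - pinv R * (R * (pinv R * (R * E)))"
    using R E P by (simp add: mult_minus_distrib_dim)
  then have 0: "pinv R * (R * D) = 0\<^sub>m n k" using pinv_mult_absorb[OF R RE] P RE by simp
  have "mat_inner H D = mat_inner (pinv R * (R * H)) D"
    using pinv_mult_absorb[OF R W] by (simp add: H_def)
  also have "\<dots> = mat_inner H (0\<^sub>m n k)" using mat_inner_pinv_mult[OF R H D] 0 by simp
  also have "\<dots> = 0" using H by (auto simp: mat_inner_def)
  finally show ?thesis
    using D H mat_inner_commute[OF D H] unfolding H_def[symmetric]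
    by (simp add: mat_inner_add_left[where r = n and c = k] mat_inner_add_right[where r = n and c = k])
qed

text \<open>Since \<open>pinv R * W\<close> has the form \<open>transpose_mat R * Z\<close>, the
  lower bound for the transpose passes to \<open>R\<close> at that matrix, whose image under
  \<open>R\<close> is \<open>W\<close> itself.\<close>

lemma mat_inner_pinv_mult_le:
  assumes R: "R \<in> carrier_mat r n" and W: "W \<in> carrier_mat r k" and \<alpha>: "0 < \<alpha>"
    and le: "\<And>Z. Z \<in> carrier_mat r k \<Longrightarrow>
      \<alpha> * mat_inner Z Z \<le> mat_inner (transpose_mat R * Z) (transpose_mat R * Z)"
  shows "mat_inner (pinv R * W) (pinv R * W) \<le> mat_inner W W / \<alpha>"
proof -
  note P = pinv_carrier[OF R]
  define Z where "Z = transpose_mat (pinv R) * (pinv R * W)"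
  have Z: "Z \<in> carrier_mat r k" using P W by (simp add: Z_def)
  have "transpose_mat R * (transpose_mat (pinv R) * pinv R) * W = transpose_mat R * Z"
    using R P W unfolding Z_def by (simp add: mult_assoc_dim)
  then have PW: "pinv R * W = transpose_mat R * Z" by (simp flip: pinv_eq_transpose_mult)
  \<comment> \<open>the lower bound makes \<open>R\<^sup>T\<close> injective, hence \<open>R R\<^sup>\<dagger>\<close> is the identity\<close>
  define N where "N = R * (pinv R * W) - W"
  have N: "N \<in> carrier_mat r k" using R P W by (auto simp: N_def intro!: minus_carrier_mat)
  have "transpose_mat (R * pinv R * R) = transpose_mat R * (R * pinv R)"
    using P R symmetric_mult_pinv[of R] by (subst transpose_mult_dim) auto
  then have "transpose_mat R * (R * pinv R) = transpose_mat R"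
    using R P by (simp add: mult_assoc_dim mult_pinv_mult)
  then have "transpose_mat R * (R * pinv R) * W = transpose_mat R * W" by simp
  then have "transpose_mat R * N = 0\<^sub>m n k"
    unfolding N_def using R P W by (simp add: mult_assoc_dim mult_minus_distrib_dim)
  then have "\<alpha> * mat_inner N N \<le> 0" using le[OF N] by (simp add: mat_inner_def)
  then have "mat_inner N N = 0"
    using \<alpha> mat_inner_self_nonneg[of N] by (simp add: mult_le_0_iff)
  then have "N = 0\<^sub>m r k" by (rule mat_inner_self_eq_0D[OF N])
  then have RPW: "R * (pinv R * W) = W"
    unfolding N_def using R P W by (subst (asm) minus_eq_0_mat_iff) auto
  have "\<alpha> * mat_inner (pinv R * W) (pinv R * W) \<le> mat_inner W W"
    using mult_lower_bound_transpose[OF R _ Z le[OF Z]] \<alpha> RPW by (simp flip: PW)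
  then show ?thesis using \<alpha> by (simp add: field_simps)
qed

text \<open>A row block is \<open>Q * C\<close> for a selection matrix \<open>Q\<close>, so its row
  space lies in that of \<open>C\<close>. Corrections by a single block therefore never leave the
  row space of the whole matrix.\<close>

lemma pinv_rows_of_mult_range:
  assumes C: "C \<in> carrier_mat m n" and W: "W \<in> carrier_mat (dim_row (rows_of C I)) k"
  shows "\<exists>Z\<in>carrier_mat m k. pinv (rows_of C I) * W = transpose_mat C * Z"
proof -
  define R where "R = rows_of C I"
  define Q where "Q = rows_of (1\<^sub>m m :: real mat) I"
  have R: "R \<in> carrier_mat (dim_row R) n" using C by (auto simp: R_def dim_rows_of)
  have Q: "Q \<in> carrier_mat (dim_row R) m" using C by (auto simp: Q_def R_def dim_rows_of)
  note P = pinv_carrier[OF R]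
  have RQ: "R = Q * C" using rows_of_eq_mult[of C I] C by (simp add: R_def Q_def)
  have W': "W \<in> carrier_mat (dim_row R) k" using W by (simp add: R_def)
  have "pinv R * W = transpose_mat R * (transpose_mat (pinv R) * pinv R) * W"
    by (simp flip: pinv_eq_transpose_mult)
  also have "transpose_mat R = transpose_mat C * transpose_mat Q"
    unfolding RQ using Q C by (intro transpose_mult_dim) simp
  also have "transpose_mat C * transpose_mat Q * (transpose_mat (pinv R) * pinv R) * W
      = transpose_mat C * (transpose_mat Q * (transpose_mat (pinv R) * (pinv R * W)))"
    using C Q P W' by (simp add: mult_assoc_dim)
  finally show ?thesis
    using C Q P W' unfolding R_def[symmetric]
    by (intro bexI[of _ "transpose_mat Q * (transpose_mat (pinv R) * (pinv R * W))"])
      (auto intro!: mult_carrier_mat)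
qed

section \<open>Sums over all blocks of a partition\<close>

context
  fixes C :: "real mat" and m n s :: nat and \<pi> :: "nat \<Rightarrow> nat" and \<beta> :: real and R :: "nat \<Rightarrow> real mat"
  assumes C: "C \<in> carrier_mat m n" and \<pi>: "\<pi> permutes {..<m}" and s: "0 < s" and \<beta>: "0 < \<beta>"
    and R_def: "R = (\<lambda>b. rows_of C (part_block \<pi> m s b))"
    and R_le: "\<And>b k W. b < s \<Longrightarrow> W \<in> carrier_mat n k \<Longrightarrow> mat_inner (R b * W) (R b * W) \<le> \<beta> * mat_inner W W"
begin

lemma block_rows_carrier: "R b \<in> carrier_mat (dim_row (R b)) n"
  using C by (auto simp: R_def dim_rows_of)

text \<open>Adds up the paving bounds of the \<open>s\<close> blocks. It later shows that the
  squared least singular value is at most \<open>s * \<beta>\<close>, so that the contraction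
  factors are nonnegative.\<close>

lemma mult_le_of_blocks:
  assumes W: "W \<in> carrier_mat n k"
  shows "mat_inner (C * W) (C * W) \<le> real s * \<beta> * mat_inner W W"
proof -
  have CW: "C * W \<in> carrier_mat m k" using C W by simp
  have "R b * W = rows_of (C * W) (part_block \<pi> m s b)" for b
    unfolding R_def using C W by (subst rows_of_mult) auto
  then have "mat_inner (C * W) (C * W) = (\<Sum>b<s. mat_inner (R b * W) (R b * W))"
    using sum_mat_inner_rows_of_part_block[OF CW \<pi> s] by simp
  also have "\<dots> \<le> (\<Sum>b<s. \<beta> * mat_inner W W)" using R_le[OF _ W] by (intro sum_mono) auto
  finally show ?thesis by simp
qed

text \<open>The drops of the individual blocks add up to the squared norm of \<open>C * E\<close>
  divided by \<beta>. The constant \<open>c\<close> is left open: the explicit bound uses a squared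
  singular value, linear convergence a positive constant.\<close>

lemma sum_residual_le:
  assumes E: "E \<in> carrier_mat n k" and c: "c * mat_inner E E \<le> mat_inner (C * E) (C * E)"
  shows "(\<Sum>b<s. mat_inner (E - pinv (R b) * (R b * E)) (E - pinv (R b) * (R b * E)))
    \<le> (real s - c / \<beta>) * mat_inner E E"
proof -
  have CE: "C * E \<in> carrier_mat m k" using C E by simp
  have "R b * E = rows_of (C * E) (part_block \<pi> m s b)" for b
    unfolding R_def using C E by (subst rows_of_mult) auto
  then have sum: "(\<Sum>b<s. mat_inner (R b * E) (R b * E)) = mat_inner (C * E) (C * E)"
    using sum_mat_inner_rows_of_part_block[OF CE \<pi> s] by simp
  have "(\<Sum>b<s. mat_inner (E - pinv (R b) * (R b * E)) (E - pinv (R b) * (R b * E)))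
      \<le> (\<Sum>b<s. mat_inner E E - mat_inner (R b * E) (R b * E) / \<beta>)"
    by (intro sum_mono mat_inner_residual_le[OF block_rows_carrier E \<beta>] R_le) auto
  also have "\<dots> = real s * mat_inner E E - mat_inner (C * E) (C * E) / \<beta>"
    by (simp add: sum_subtractf sum flip: sum_divide_distrib)
  also have "\<dots> \<le> real s * mat_inner E E - c * mat_inner E E / \<beta>"
    using c \<beta> by (simp add: divide_right_mono)
  finally show ?thesis by (simp add: algebra_simps)
qed

lemma sum_residual_add_le:
  assumes E: "E \<in> carrier_mat n k" and c: "c * mat_inner E E \<le> mat_inner (C * E) (C * E)"
    and G: "G \<in> carrier_mat m k" and \<alpha>: "0 < \<alpha>"
    and le: "\<And>b Z. b < s \<Longrightarrow> Z \<in> carrier_mat (dim_row (R b)) k \<Longrightarrow>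
      \<alpha> * mat_inner Z Z \<le> mat_inner (transpose_mat (R b) * Z) (transpose_mat (R b) * Z)"
  shows "(\<Sum>b<s. mat_inner
        (E - pinv (R b) * (R b * E) + pinv (R b) * rows_of G (part_block \<pi> m s b))
        (E - pinv (R b) * (R b * E) + pinv (R b) * rows_of G (part_block \<pi> m s b)))
    \<le> (real s - c / \<beta>) * mat_inner E E + mat_inner G G / \<alpha>"
proof -
  define g where "g b = rows_of G (part_block \<pi> m s b)" for b
  have g: "g b \<in> carrier_mat (dim_row (R b)) k" for b
    using C G by (auto simp: g_def R_def dim_rows_of)
  have "(\<Sum>b<s. mat_inner (E - pinv (R b) * (R b * E) + pinv (R b) * g b)
        (E - pinv (R b) * (R b * E) + pinv (R b) * g b))
      = (\<Sum>b<s. mat_inner (E - pinv (R b) * (R b * E)) (E - pinv (R b) * (R b * E)))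
        + (\<Sum>b<s. mat_inner (pinv (R b) * g b) (pinv (R b) * g b))"
    by (simp add: mat_inner_residual_add[OF block_rows_carrier E g] sum.distrib)
  also have "\<dots> \<le> (real s - c / \<beta>) * mat_inner E E + (\<Sum>b<s. mat_inner (g b) (g b) / \<alpha>)"
    by (intro add_mono sum_residual_le[OF E c] sum_mono mat_inner_pinv_mult_le[OF block_rows_carrier g \<alpha>] le) auto
  also have "(\<Sum>b<s. mat_inner (g b) (g b) / \<alpha>) = mat_inner G G / \<alpha>"
    using sum_mat_inner_rows_of_part_block[OF G \<pi> s] by (simp add: g_def flip: sum_divide_distrib)
  finally show ?thesis by (simp add: g_def)
qed

end

section \<open>Errors after one row step and one column step\<close>

lemma arbk_Y_step_error:
  fixes I :: "nat set"
  assumes A: "A \<in> carrier_mat m n" and Y: "Y \<in> carrier_mat n q" and Ys: "Ys \<in> carrier_mat n q"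
    and F: "A * Ys = F"
  defines "R \<equiv> rows_of A I"
  shows "arbk_Y_step A F I Y - Ys = (Y - Ys) - pinv R * (R * (Y - Ys))"
proof -
  define r where "r = dim_row R"
  have R: "R \<in> carrier_mat r n" using A by (auto simp: r_def R_def dim_rows_of)
  note P = pinv_carrier[OF R]
  have FR: "rows_of F I = R * Ys" unfolding F[symmetric] R_def using A Ys by (intro rows_of_mult) simp
  define a where "a = pinv R * (R * Y)"
  define b where "b = pinv R * (R * Ys)"
  have ab: "a \<in> carrier_mat n q" "b \<in> carrier_mat n q"
    unfolding a_def b_def by (rule mult_carrier_mat[OF P mult_carrier_mat[OF R Y]]
        mult_carrier_mat[OF P mult_carrier_mat[OF R Ys]])+
  have "arbk_Y_step A F I Y = Y + (b - a)"
    unfolding arbk_Y_step_def FR R_def[symmetric] a_def b_def using R P Y Ys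
    by (simp add: mult_minus_distrib_dim)
  moreover have "pinv R * (R * (Y - Ys)) = a - b"
    unfolding a_def b_def using R P Y Ys by (simp add: mult_minus_distrib_dim)
  moreover have "Y + (b - a) - Ys = (Y - Ys) - (a - b)"
    using ab Y Ys by (intro eq_matI) auto
  ultimately show ?thesis by simp
qed

text \<open>Transposition turns the column step into a row step for \<open>transpose_mat B\<close>.
  The data \<open>Y\<close> differs from \<open>Ys\<close>, and this difference appears as the added
  pseudoinverse term.\<close>

lemma arbk_X_step_error:
  fixes I :: "nat set"
  assumes B: "B \<in> carrier_mat p q" and X: "X \<in> carrier_mat n p" and Xs: "Xs \<in> carrier_mat n p"
    and Y: "Y \<in> carrier_mat n q" and Ys: "Xs * B = Ys"
  defines "R \<equiv> rows_of (transpose_mat B) I"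
    and "E \<equiv> transpose_mat (X - Xs)"
  shows "transpose_mat (arbk_X_step B I Y X - Xs)
    = E - pinv R * (R * E) + pinv R * rows_of (transpose_mat (Y - Ys)) I"
proof -
  define r where "r = dim_row R"
  have R: "R \<in> carrier_mat r p" using B by (auto simp: r_def R_def dim_rows_of)
  note P = pinv_carrier[OF R]
  have Ys': "Ys \<in> carrier_mat n q" using Xs B Ys by auto
  have BI: "cols_of B I = transpose_mat R" by (simp add: cols_of_eq R_def)
  define y where "y = rows_of (transpose_mat Y) I"
  have y: "y \<in> carrier_mat r n" using Y B by (auto simp: r_def y_def R_def dim_rows_of)
  have YI: "cols_of Y I = transpose_mat y" by (simp add: cols_of_eq y_def)
  have "rows_of (transpose_mat (Y - Ys)) I = y - rows_of (transpose_mat Ys) I"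
    using Y Ys' unfolding y_def by (simp add: transpose_minus rows_of_minus)
  also have "rows_of (transpose_mat Ys) I = R * transpose_mat Xs"
    unfolding Ys[symmetric] R_def using Xs B by (simp add: transpose_mult_dim rows_of_mult)
  finally have g: "rows_of (transpose_mat (Y - Ys)) I = y - R * transpose_mat Xs" .
  define a where "a = pinv R * (R * transpose_mat X)"
  define b where "b = pinv R * (R * transpose_mat Xs)"
  define d where "d = pinv R * y"
  have abd: "a \<in> carrier_mat p n" "b \<in> carrier_mat p n" "d \<in> carrier_mat p n"
    unfolding a_def b_def d_def using mult_carrier_mat[OF P mult_carrier_mat[OF R]] mult_carrier_mat[OF P y] X Xs
    by simp_all
  have "transpose_mat ((transpose_mat y - X * transpose_mat R) * transpose_mat (pinv R)) = d - a"
  proof -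
    have M: "transpose_mat y - X * transpose_mat R \<in> carrier_mat n r"
      using y X R by (auto intro!: minus_carrier_mat)
    have "transpose_mat (transpose_mat y - X * transpose_mat R) = y - R * transpose_mat X"
      using y X R by (subst transpose_minus[of _ n r]) (auto simp: transpose_mult_dim)
    then show ?thesis
      using M P R y X unfolding d_def a_def
      by (simp add: transpose_mult_dim mult_minus_distrib_dim)
  qed
  moreover have "transpose_mat (arbk_X_step B I Y X - Xs)
      = transpose_mat X + transpose_mat ((transpose_mat y - X * transpose_mat R) * transpose_mat (pinv R))
        - transpose_mat Xs"
    unfolding arbk_X_step_def BI YI pinv_transpose using X Xs y R P
    by (subst transpose_minus[of _ n p] transpose_add[of _ n p], auto)+
  ultimately have 1: "transpose_mat (arbk_X_step B I Y X - Xs) = transpose_mat X + (d - a) - transpose_mat Xs"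
    by simp
  have E: "E = transpose_mat X - transpose_mat Xs" unfolding E_def by (rule transpose_minus[OF X Xs])
  have 2: "pinv R * (R * E) = a - b"
    unfolding E a_def b_def using X Xs R P by (simp add: mult_minus_distrib_dim)
  have 3: "pinv R * (y - R * transpose_mat Xs) = d - b"
    unfolding d_def b_def using Xs R P y by (simp add: mult_minus_distrib_dim)
  show ?thesis unfolding 1 2 g 3 unfolding E
    using abd X Xs by (intro eq_matI) auto
qed

section \<open>Averaging over a uniform selection\<close>

context prob_space
begin

context
  fixes c :: "'i \<Rightarrow> 'a \<Rightarrow> nat" and N :: "'i \<Rightarrow> nat"
  assumes indep: "indep_vars (\<lambda>_. count_space UNIV) c UNIV"
    and unif: "\<And>a. uniform_selection M (N a) (c a)" and N: "\<And>a. 0 < N a"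
begin

lemma selection_measurable: "c a \<in> measurable M (count_space UNIV)"
  using indep by (auto simp: indep_vars_def)

lemma selection_distr: "distr M (count_space UNIV) (c a) = measure_pmf (pmf_of_set {..<N a})"
  using unif by (simp add: uniform_selection_def)

lemma set_pmf_selection: "set_pmf (pmf_of_set {..<N a}) = {..<N a}"
  using N[of a] by (subst set_pmf_of_set) auto

lemma AE_selection_less: "AE \<omega> in M. c a \<omega> < N a"
proof -
  have "AE x in distr M (count_space UNIV) (c a). x < N a"
    unfolding selection_distr AE_measure_pmf_iff set_pmf_selection by simp
  then show ?thesis by (rule AE_distrD[OF selection_measurable])
qed

lemma expectation_indicator_selection:
  assumes "u < N a"
  shows "(\<integral>\<omega>. indicator {u} (c a \<omega>) \<partial>M) = (1 / real (N a) :: real)"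
proof -
  have "(\<integral>\<omega>. indicator {u} (c a \<omega>) \<partial>M) = (\<integral>x. indicator {u} x \<partial>distr M (count_space UNIV) (c a) :: real)"
    by (rule integral_distr[OF selection_measurable, symmetric]) simp
  also have "\<dots> = pmf (pmf_of_set {..<N a}) u"
    unfolding selection_distr by (simp add: pmf.rep_eq)
  also have "\<dots> = 1 / real (N a)"
    using assms by (subst pmf_of_set) (auto simp: indicator_def lessThan_empty_iff)
  finally show ?thesis .
qed

text \<open>A finite product of countable discrete spaces is discrete, so every real function of
  finitely many selections is measurable, and no measurable structure on matrices has to be
  introduced.\<close>

lemma history_function_measurable:
  fixes \<Psi> :: "('i \<Rightarrow> nat) \<Rightarrow> real"
  assumes K: "finite K"
  shows "\<Psi> \<in> borel_measurable (PiM K (\<lambda>_. count_space UNIV))"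
    and "(\<lambda>\<omega>. \<Psi> (restrict (\<lambda>b. c b \<omega>) K)) \<in> borel_measurable M"
proof -
  show 1: "\<Psi> \<in> borel_measurable (PiM K (\<lambda>_. count_space UNIV))"
    by (subst count_space_PiM_finite[OF K]) auto
  have "(\<lambda>\<omega>. restrict (\<lambda>b. c b \<omega>) K) \<in> measurable M (PiM K (\<lambda>_. count_space UNIV))"
    by (rule measurable_restrict) (rule selection_measurable)
  then show "(\<lambda>\<omega>. \<Psi> (restrict (\<lambda>b. c b \<omega>) K)) \<in> borel_measurable M"
    by (rule measurable_compose[OF _ 1])
qed

text \<open>Almost surely the selections lie in the finite set \<open>H\<close>, and the sum of the
  absolute values over \<open>H\<close> is a constant bound.\<close>

lemma history_function_integrable:
  fixes \<Psi> :: "('i \<Rightarrow> nat) \<Rightarrow> real"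
  assumes K: "finite K"
  shows "integrable M (\<lambda>\<omega>. \<Psi> (restrict (\<lambda>b. c b \<omega>) K))"
proof -
  define H where "H = PiE K (\<lambda>a. {..<N a})"
  have finH: "finite H" unfolding H_def using K by (intro finite_PiE) auto
  have "AE \<omega> in M. \<forall>a\<in>K. c a \<omega> < N a"
    using K AE_selection_less by (intro AE_finite_allI) auto
  then have "AE \<omega> in M. norm (\<Psi> (restrict (\<lambda>b. c b \<omega>) K)) \<le> (\<Sum>h\<in>H. \<bar>\<Psi> h\<bar>)"
  proof (eventually_elim)
    case (elim \<omega>)
    then have "restrict (\<lambda>b. c b \<omega>) K \<in> H" by (auto simp: H_def)
    then show ?case using finH by (simp add: member_le_sum[of _ H "\<lambda>h. \<bar>\<Psi> h\<bar>"])
  qed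
  then show ?thesis by (rule integrable_const_bound[OF _ history_function_measurable(2)[OF K]])
qed

text \<open>Plays the part of conditioning on the past: the integrand is split by the value
  \<open>u\<close> of the new selection, whose indicator is independent of the earlier ones and has
  expectation \<open>1 / N a\<close>.\<close>

lemma expectation_next_selection:
  fixes \<Phi> :: "nat \<Rightarrow> ('i \<Rightarrow> nat) \<Rightarrow> real"
  assumes K: "finite K" and a: "a \<notin> K"
  shows "(\<integral>\<omega>. \<Phi> (c a \<omega>) (restrict (\<lambda>b. c b \<omega>) K) \<partial>M)
    = (\<integral>\<omega>. (\<Sum>u<N a. \<Phi> u (restrict (\<lambda>b. c b \<omega>) K)) / real (N a) \<partial>M)"
proof -
  define h where "h \<omega> = restrict (\<lambda>b. c b \<omega>) K" for \<omega>
  have int: "integrable M (\<lambda>\<omega>. \<Phi> u (h \<omega>))" for u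
    unfolding h_def by (rule history_function_integrable[OF K])
  have "integrable M (\<lambda>\<omega>. (\<lambda>g. indicator {u} (g a)) (restrict (\<lambda>b. c b \<omega>) {a}) :: real)" for u
    by (rule history_function_integrable) simp
  then have int_ind: "integrable M (\<lambda>\<omega>. indicator {u} (c a \<omega>) :: real)" for u by simp
  have indep_u: "indep_var borel (\<lambda>\<omega>. indicator {u} (c a \<omega>) :: real) borel (\<lambda>\<omega>. \<Phi> u (h \<omega>))" for u
  proof -
    have "indep_var borel ((\<lambda>g. indicator {u} (g a) :: real) \<circ> (\<lambda>\<omega>. restrict (\<lambda>b. c b \<omega>) {a}))
        borel (\<Phi> u \<circ> (\<lambda>\<omega>. restrict (\<lambda>b. c b \<omega>) K))"
      using a K
      by (intro indep_var_compose[OF indep_var_restrict[OF indep]] history_function_measurable) auto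
    then show ?thesis by (simp add: comp_def h_def)
  qed
  have meas: "(\<lambda>\<omega>. \<Phi> (c a \<omega>) (h \<omega>)) \<in> borel_measurable M"
  proof -
    have "(\<lambda>\<omega>. (\<lambda>g. \<Phi> (g a) (restrict g K)) (restrict (\<lambda>b. c b \<omega>) (insert a K))) \<in> borel_measurable M"
      using K by (intro history_function_measurable(2)) simp
    moreover have "restrict (restrict (\<lambda>b. c b \<omega>) (insert a K)) K = h \<omega>" for \<omega>
      by (auto simp: h_def restrict_def)
    ultimately show ?thesis by simp
  qed
  have pick_term: "indicator {u} k * x = (if k = u then x else 0)" for u k :: nat and x :: real
    by (simp add: indicator_def)
  have "(\<integral>\<omega>. \<Phi> (c a \<omega>) (h \<omega>) \<partial>M) = (\<integral>\<omega>. (\<Sum>u<N a. indicator {u} (c a \<omega>) * \<Phi> u (h \<omega>)) \<partial>M)"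
  proof (rule integral_cong_AE[OF meas])
    show "(\<lambda>\<omega>. \<Sum>u<N a. indicator {u} (c a \<omega>) * \<Phi> u (h \<omega>)) \<in> borel_measurable M"
      using int int_ind by (intro borel_measurable_sum borel_measurable_times borel_measurable_integrable)
    show "AE \<omega> in M. \<Phi> (c a \<omega>) (h \<omega>) = (\<Sum>u<N a. indicator {u} (c a \<omega>) * \<Phi> u (h \<omega>))"
      using AE_selection_less[of a] by eventually_elim (simp add: pick_term)
  qed
  also have "\<dots> = (\<Sum>u<N a. \<integral>\<omega>. indicator {u} (c a \<omega>) * \<Phi> u (h \<omega>) \<partial>M)"
    by (intro Bochner_Integration.integral_sum indep_var_integrable[OF indep_u int_ind int])
  also have "\<dots> = (\<Sum>u<N a. (\<integral>\<omega>. \<Phi> u (h \<omega>) \<partial>M) / real (N a))"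
    by (intro sum.cong refl)
      (simp add: indep_var_lebesgue_integral[OF indep_u int_ind int] expectation_indicator_selection)
  also have "\<dots> = (\<integral>\<omega>. (\<Sum>u<N a. \<Phi> u (h \<omega>)) / real (N a) \<partial>M)"
    using int by (simp add: Bochner_Integration.integral_sum sum_divide_distrib)
  finally show ?thesis by (simp add: h_def)
qed

end

end

section \<open>The mean square recursion of ARBK\<close>

text \<open>The iterate depends only on selections made before iteration \<open>k\<close>, which
  permits replacing the sample path by its finite history.\<close>

lemma arbk_cong:
  assumes "\<And>l. l < k \<Longrightarrow> i l = i' l" "\<And>l. l < k \<Longrightarrow> j l = j' l"
  shows "arbk A B F U V X0 Y0 i j k = arbk A B F U V X0 Y0 i' j' k"
  using assms
proof (induction k)
  case (Suc k)
  have "arbk A B F U V X0 Y0 i j k = arbk A B F U V X0 Y0 i' j' k"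
    by (rule Suc.IH) (use Suc.prems in auto)
  then show ?case using Suc.prems[of k] by simp
qed simp

lemma snd_arbk_Suc:
  "snd (arbk A B F U V X0 Y0 i j (Suc k)) = arbk_Y_step A F (U (i k)) (snd (arbk A B F U V X0 Y0 i j k))"
  by (simp add: case_prod_unfold Let_def)

lemma fst_arbk_Suc:
  "fst (arbk A B F U V X0 Y0 i j (Suc k))
    = arbk_X_step B (V (j k)) (snd (arbk A B F U V X0 Y0 i j (Suc k))) (fst (arbk A B F U V X0 Y0 i j k))"
  by (simp add: case_prod_unfold Let_def)

declare arbk.simps(2) [simp del]

section \<open>Ranges preserved by the iteration and averaged one-step bounds\<close>

context
  fixes A B F Ys Xs X0 :: "real mat" and m n p q s t :: nat and \<pi>U \<pi>V :: "nat \<Rightarrow> nat"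
    and U V :: "nat \<Rightarrow> nat set" and \<beta>A \<alpha>B \<beta>B :: real
  assumes A: "A \<in> carrier_mat m n" and B: "B \<in> carrier_mat p q" and X0: "X0 \<in> carrier_mat n p"
    and Ys: "Ys \<in> carrier_mat n q" "A * Ys = F" and Xs: "Xs \<in> carrier_mat n p" "Xs * B = Ys"
    and Y0_range: "\<exists>Z\<in>carrier_mat m q. X0 * B - Ys = transpose_mat A * Z"
    and X0_range: "\<exists>Z\<in>carrier_mat q n. transpose_mat (X0 - Xs) = B * Z"
    and \<pi>U: "\<pi>U permutes {..<m}" and \<pi>V: "\<pi>V permutes {..<q}" and s: "0 < s" and t: "0 < t"
    and U: "U = part_block \<pi>U m s" and V: "V = part_block \<pi>V q t"
    and \<beta>A: "0 < \<beta>A" and \<alpha>B: "0 < \<alpha>B" and \<beta>B: "0 < \<beta>B"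
    and A_le: "\<And>b k W. b < s \<Longrightarrow> W \<in> carrier_mat n k \<Longrightarrow>
      mat_inner (rows_of A (U b) * W) (rows_of A (U b) * W) \<le> \<beta>A * mat_inner W W"
    and B_le: "\<And>b k W. b < t \<Longrightarrow> W \<in> carrier_mat p k \<Longrightarrow>
      mat_inner (rows_of (transpose_mat B) (V b) * W) (rows_of (transpose_mat B) (V b) * W)
        \<le> \<beta>B * mat_inner W W"
    and B_ge: "\<And>b k Z. b < t \<Longrightarrow> Z \<in> carrier_mat (dim_row (rows_of (transpose_mat B) (V b))) k \<Longrightarrow>
      \<alpha>B * mat_inner Z Z
        \<le> mat_inner (transpose_mat (rows_of (transpose_mat B) (V b)) * Z)
            (transpose_mat (rows_of (transpose_mat B) (V b)) * Z)"
begin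

text \<open>The constants bounding \<open>A\<close> and \<open>transpose_mat B\<close> from below
  are valid only on the row space of \<open>A\<close> and the column space of \<open>B\<close>.
  Membership of the errors there must accompany the iterates.\<close>

abbreviation (input) "row_invariant Y \<equiv>
  Y \<in> carrier_mat n q \<and> (\<exists>Z\<in>carrier_mat m q. Y - Ys = transpose_mat A * Z)"

abbreviation (input) "col_invariant X \<equiv>
  X \<in> carrier_mat n p \<and> (\<exists>Z\<in>carrier_mat q n. transpose_mat (X - Xs) = B * Z)"

lemma arbk_Y_step_invariant:
  assumes "row_invariant Y"
  shows "row_invariant (arbk_Y_step A F I Y)"
proof -
  obtain Z where Y: "Y \<in> carrier_mat n q" and Z: "Z \<in> carrier_mat m q" "Y - Ys = transpose_mat A * Z"
    using assms by auto
  define r where "r = dim_row (rows_of A I)"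
  have R: "rows_of A I \<in> carrier_mat r n" using A by (auto simp: r_def dim_rows_of)
  have E: "Y - Ys \<in> carrier_mat n q" using Ys(1) by (rule minus_carrier_mat)
  have "rows_of A I * (Y - Ys) \<in> carrier_mat (dim_row (rows_of A I)) q"
    unfolding r_def[symmetric] by (rule mult_carrier_mat[OF R E])
  then obtain Z' where Z': "Z' \<in> carrier_mat m q"
    "pinv (rows_of A I) * (rows_of A I * (Y - Ys)) = transpose_mat A * Z'"
    using pinv_rows_of_mult_range[OF A, of _ I q] by blast
  have AT: "transpose_mat A \<in> carrier_mat n m" using A by simp
  have "arbk_Y_step A F I Y - Ys = transpose_mat A * (Z - Z')"
    unfolding arbk_Y_step_error[OF A Y Ys] Z'(2) unfolding Z(2)
    by (rule mult_minus_distrib_mat[OF AT Z(1) Z'(1), symmetric])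
  moreover have "Z - Z' \<in> carrier_mat m q" using Z'(1) by (rule minus_carrier_mat)
  moreover have "arbk_Y_step A F I Y \<in> carrier_mat n q"
  proof -
    have "pinv (rows_of A I) * (rows_of F I - rows_of A I * Y) \<in> carrier_mat n q"
      by (rule mult_carrier_mat[OF pinv_carrier[OF R]]
          minus_carrier_mat mult_carrier_mat[OF R Y])+
    then show ?thesis unfolding arbk_Y_step_def using Y by simp
  qed
  ultimately show ?thesis by blast
qed

lemma arbk_X_step_invariant:
  assumes Y: "Y \<in> carrier_mat n q" and "col_invariant X"
  shows "col_invariant (arbk_X_step B I Y X)"
proof -
  obtain Z where X: "X \<in> carrier_mat n p" and Z: "Z \<in> carrier_mat q n" "transpose_mat (X - Xs) = B * Z"
    using assms by auto
  have BT: "transpose_mat B \<in> carrier_mat q p" using B by simp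
  define r where "r = dim_row (rows_of (transpose_mat B) I)"
  define E where "E = transpose_mat (X - Xs)"
  define g where "g = rows_of (transpose_mat (Y - Ys)) I"
  have R: "rows_of (transpose_mat B) I \<in> carrier_mat r p" using BT by (auto simp: r_def dim_rows_of)
  have E: "E \<in> carrier_mat p n" using minus_carrier_mat[OF Xs(1), of X] by (simp add: E_def)
  have g: "g \<in> carrier_mat (dim_row (rows_of (transpose_mat B) I)) n"
    using Ys(1) B by (auto simp: g_def dim_rows_of)
  have RE: "rows_of (transpose_mat B) I * E \<in> carrier_mat (dim_row (rows_of (transpose_mat B) I)) n"
    unfolding r_def[symmetric] by (rule mult_carrier_mat[OF R E])
  obtain Z' where Z': "Z' \<in> carrier_mat q n"
    "pinv (rows_of (transpose_mat B) I) * (rows_of (transpose_mat B) I * E) = B * Z'"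
    using pinv_rows_of_mult_range[OF BT RE] by auto
  obtain Z'' where Z'': "Z'' \<in> carrier_mat q n" "pinv (rows_of (transpose_mat B) I) * g = B * Z''"
    using pinv_rows_of_mult_range[OF BT g] by auto
  have ZZ: "Z - Z' \<in> carrier_mat q n" using Z'(1) by (rule minus_carrier_mat)
  have "transpose_mat (arbk_X_step B I Y X - Xs) = B * Z - B * Z' + B * Z''"
    using arbk_X_step_error[OF B X Xs(1) Y Xs(2), of I] Z Z'(2) Z''(2) by (simp add: E_def g_def)
  also have "B * Z - B * Z' = B * (Z - Z')"
    by (rule mult_minus_distrib_mat[OF B Z(1) Z'(1), symmetric])
  also have "B * (Z - Z') + B * Z'' = B * (Z - Z' + Z'')"
    by (rule mult_add_distrib_mat[OF B ZZ Z''(1), symmetric])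
  finally have "transpose_mat (arbk_X_step B I Y X - Xs) = B * (Z - Z' + Z'')" .
  moreover have "Z - Z' + Z'' \<in> carrier_mat q n" using Z''(1) ZZ by simp
  moreover have "arbk_X_step B I Y X \<in> carrier_mat n p"
  proof -
    have "dim_row (cols_of B I) = p" using B by (simp add: cols_of_eq dim_rows_of)
    then show ?thesis
      using X Y B dim_row_pinv[of "cols_of B I"] dim_col_pinv[of "cols_of B I"]
      by (auto simp: arbk_X_step_def cols_of_eq dim_rows_of)
  qed
  ultimately show ?thesis by blast
qed

lemma arbk_invariant:
  "row_invariant (snd (arbk A B F U V X0 (X0 * B) i j k)) \<and>
    col_invariant (fst (arbk A B F U V X0 (X0 * B) i j k))"
proof (induction k)
  case 0
  then show ?case using X0 B X0_range Y0_range by simp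
next
  case (Suc k)
  have 1: "row_invariant (snd (arbk A B F U V X0 (X0 * B) i j (Suc k)))"
    unfolding snd_arbk_Suc by (rule arbk_Y_step_invariant) (use Suc in blast)
  have "col_invariant (fst (arbk A B F U V X0 (X0 * B) i j (Suc k)))"
    unfolding fst_arbk_Suc by (rule arbk_X_step_invariant) (use 1 Suc in blast)+
  with 1 show ?case by blast
qed

lemma average_Y_step_error:
  assumes Y: "row_invariant Y"
    and a: "\<And>Z. Z \<in> carrier_mat m q \<Longrightarrow>
      a * mat_inner (transpose_mat A * Z) (transpose_mat A * Z)
        \<le> mat_inner (A * (transpose_mat A * Z)) (A * (transpose_mat A * Z))"
  shows "(\<Sum>b<s. mat_inner (arbk_Y_step A F (U b) Y - Ys) (arbk_Y_step A F (U b) Y - Ys)) / real s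
    \<le> (1 - a / (real s * \<beta>A)) * mat_inner (Y - Ys) (Y - Ys)"
proof -
  have Y': "Y \<in> carrier_mat n q" using Y by simp
  have E: "Y - Ys \<in> carrier_mat n q" using Ys(1) by (rule minus_carrier_mat)
  have c: "a * mat_inner (Y - Ys) (Y - Ys) \<le> mat_inner (A * (Y - Ys)) (A * (Y - Ys))"
    using Y a by auto
  have "(\<Sum>b<s. mat_inner (arbk_Y_step A F (U b) Y - Ys) (arbk_Y_step A F (U b) Y - Ys))
      \<le> (real s - a / \<beta>A) * mat_inner (Y - Ys) (Y - Ys)"
    unfolding arbk_Y_step_error[OF A Y' Ys]
    using sum_residual_le[OF A \<pi>U s \<beta>A refl A_le[unfolded U] E c] by (simp add: U)
  then have "(\<Sum>b<s. mat_inner (arbk_Y_step A F (U b) Y - Ys) (arbk_Y_step A F (U b) Y - Ys)) / real s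
      \<le> (real s - a / \<beta>A) * mat_inner (Y - Ys) (Y - Ys) / real s"
    by (intro divide_right_mono) simp_all
  also have "\<dots> = (real s - a / \<beta>A) / real s * mat_inner (Y - Ys) (Y - Ys)" by simp
  also have "(real s - a / \<beta>A) / real s = 1 - a / (real s * \<beta>A)"
    using s by (simp add: diff_divide_distrib mult.commute)
  finally show ?thesis .
qed

lemma average_X_step_error:
  assumes X: "col_invariant X" and Y: "Y \<in> carrier_mat n q"
    and c: "\<And>Z. Z \<in> carrier_mat q n \<Longrightarrow>
      c * mat_inner (B * Z) (B * Z)
        \<le> mat_inner (transpose_mat B * (B * Z)) (transpose_mat B * (B * Z))"
  shows "(\<Sum>b<t. mat_inner (arbk_X_step B (V b) Y X - Xs) (arbk_X_step B (V b) Y X - Xs)) / real t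
    \<le> (1 - c / (real t * \<beta>B)) * mat_inner (X - Xs) (X - Xs)
      + mat_inner (Y - Ys) (Y - Ys) / (real t * \<alpha>B)"
proof -
  have X': "X \<in> carrier_mat n p" using X by simp
  have BT: "transpose_mat B \<in> carrier_mat q p" using B by simp
  define E where "E = transpose_mat (X - Xs)"
  define G where "G = transpose_mat (Y - Ys)"
  have XX: "X - Xs \<in> carrier_mat n p" using Xs(1) by (rule minus_carrier_mat)
  have YY: "Y - Ys \<in> carrier_mat n q" using Ys(1) by (rule minus_carrier_mat)
  have E: "E \<in> carrier_mat p n" using XX by (simp add: E_def)
  have G: "G \<in> carrier_mat q n" using YY by (simp add: G_def)
  have cE: "c * mat_inner E E \<le> mat_inner (transpose_mat B * E) (transpose_mat B * E)"
    using X c by (auto simp: E_def)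
  \<comment> \<open>Transposing preserves the Frobenius norm and brings the errors into the form of
    the row block estimates.\<close>
  have tr: "mat_inner (arbk_X_step B I Y X - Xs) (arbk_X_step B I Y X - Xs)
      = mat_inner (transpose_mat (arbk_X_step B I Y X - Xs)) (transpose_mat (arbk_X_step B I Y X - Xs))" for I
    using minus_carrier_mat[OF Xs(1)] minus_carrier_mat[OF Xs(1)] by (rule mat_inner_transpose[symmetric])
  have "(\<Sum>b<t. mat_inner (arbk_X_step B (V b) Y X - Xs) (arbk_X_step B (V b) Y X - Xs))
      \<le> (real t - c / \<beta>B) * mat_inner E E + mat_inner G G / \<alpha>B"
    unfolding tr arbk_X_step_error[OF B X' Xs(1) Y Xs(2)]
    using sum_residual_add_le[OF BT \<pi>V t \<beta>B refl B_le[unfolded V] E cE G \<alpha>B B_ge[unfolded V]]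
    by (simp add: V E_def G_def)
  moreover have "mat_inner E E = mat_inner (X - Xs) (X - Xs)" "mat_inner G G = mat_inner (Y - Ys) (Y - Ys)"
    unfolding E_def G_def by (rule mat_inner_transpose[OF XX XX] mat_inner_transpose[OF YY YY])+
  ultimately have "(\<Sum>b<t. mat_inner (arbk_X_step B (V b) Y X - Xs) (arbk_X_step B (V b) Y X - Xs)) / real t
      \<le> ((real t - c / \<beta>B) * mat_inner (X - Xs) (X - Xs) + mat_inner (Y - Ys) (Y - Ys) / \<alpha>B) / real t"
    by (intro divide_right_mono) simp_all
  also have "\<dots> = (real t - c / \<beta>B) / real t * mat_inner (X - Xs) (X - Xs)
      + mat_inner (Y - Ys) (Y - Ys) / (real t * \<alpha>B)"
    by (simp add: add_divide_distrib mult.commute)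
  also have "(real t - c / \<beta>B) / real t = 1 - c / (real t * \<beta>B)"
    using t by (simp add: diff_divide_distrib mult.commute)
  finally show ?thesis .
qed

section \<open>Recursion for the expected squared errors\<close>

context
  fixes M :: "'w measure" and i j :: "nat \<Rightarrow> 'w \<Rightarrow> nat" and dX dY :: "nat \<Rightarrow> 'w \<Rightarrow> real"
  assumes M: "prob_space M" and sel: "random_selections M s t i j"
    and dX: "\<And>k \<omega>. dX k \<omega> =
      (let D = fst (arbk A B F U V X0 (X0 * B) (\<lambda>l. i l \<omega>) (\<lambda>l. j l \<omega>) k) - Xs in mat_inner D D)"
    and dY: "\<And>k \<omega>. dY k \<omega> =
      (let D = snd (arbk A B F U V X0 (X0 * B) (\<lambda>l. i l \<omega>) (\<lambda>l. j l \<omega>) k) - Ys in mat_inner D D)"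
begin

interpretation prob_space M by (rule M)

text \<open>\<open>Inl l\<close> stands for the row selection and \<open>Inr l\<close> for the
  column selection of iteration \<open>l\<close>, so joint independence concerns a single
  family.\<close>

abbreviation (input) "choice_family \<equiv> case_sum i j"

abbreviation (input) "block_count \<equiv> case_sum (\<lambda>_. s) (\<lambda>_. t) :: nat + nat \<Rightarrow> nat"

lemma choice_family_indep: "indep_vars (\<lambda>_. count_space UNIV) choice_family UNIV"
  using sel by (simp add: random_selections_def)

lemma choice_family_uniform: "uniform_selection M (block_count a) (choice_family a)"
  using sel by (cases a) (auto simp: random_selections_def)

lemma block_count_pos: "0 < block_count a"
  using s t by (cases a) auto

lemmas choice_facts = choice_family_indep choice_family_uniform block_count_pos

abbreviation (input) "history k \<equiv> Inl ` {..<k} \<union> Inr ` {..<k} :: (nat + nat) set"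

abbreviation (input) "arbk_of h \<equiv> arbk A B F U V X0 (X0 * B) (\<lambda>l. h (Inl l)) (\<lambda>l. h (Inr l))"

lemma arbk_of_restrict:
  assumes "history k \<subseteq> K"
  shows "arbk_of (restrict (\<lambda>a. choice_family a \<omega>) K) k
    = arbk A B F U V X0 (X0 * B) (\<lambda>l. i l \<omega>) (\<lambda>l. j l \<omega>) k"
  using assms by (intro arbk_cong) auto

lemma integrable_errors: "integrable M (dX k)" "integrable M (dY k)"
proof -
  have fin: "finite (history k)" by simp
  have "integrable M (\<lambda>\<omega>. let D = fst (arbk_of (restrict (\<lambda>a. choice_family a \<omega>) (history k)) k) - Xs
      in mat_inner D D)"
    by (rule history_function_integrable[OF choice_facts fin,
          of "\<lambda>h. let D = fst (arbk_of h k) - Xs in mat_inner D D"])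
  then show "integrable M (dX k)" unfolding arbk_of_restrict[OF order_refl] dX[symmetric] .
  have "integrable M (\<lambda>\<omega>. let D = snd (arbk_of (restrict (\<lambda>a. choice_family a \<omega>) (history k)) k) - Ys
      in mat_inner D D)"
    by (rule history_function_integrable[OF choice_facts fin,
          of "\<lambda>h. let D = snd (arbk_of h k) - Ys in mat_inner D D"])
  then show "integrable M (dY k)" unfolding arbk_of_restrict[OF order_refl] dY[symmetric] .
qed

lemma expectation_dY_Suc:
  assumes a: "\<And>Z. Z \<in> carrier_mat m q \<Longrightarrow>
      a * mat_inner (transpose_mat A * Z) (transpose_mat A * Z)
        \<le> mat_inner (A * (transpose_mat A * Z)) (A * (transpose_mat A * Z))"
  shows "expectation (dY (Suc k)) \<le> (1 - a / (real s * \<beta>A)) * expectation (dY k)"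
proof -
  define \<Phi> where "\<Phi> b h = (let D = arbk_Y_step A F (U b) (snd (arbk_of h k)) - Ys in mat_inner D D)"
    for b and h :: "nat + nat \<Rightarrow> nat"
  define h where "h \<omega> = restrict (\<lambda>a. choice_family a \<omega>) (history k)" for \<omega>
  have fin: "finite (history k)" by simp
  have h: "arbk_of (h \<omega>) k = arbk A B F U V X0 (X0 * B) (\<lambda>l. i l \<omega>) (\<lambda>l. j l \<omega>) k" for \<omega>
    unfolding h_def by (rule arbk_of_restrict) simp
  have notin: "Inl k \<notin> history k" by auto
  have "dY (Suc k) = (\<lambda>\<omega>. \<Phi> (choice_family (Inl k) \<omega>) (h \<omega>))"
    by (simp add: fun_eq_iff dY \<Phi>_def h snd_arbk_Suc)
  then have "expectation (dY (Suc k)) = expectation (\<lambda>\<omega>. \<Phi> (choice_family (Inl k) \<omega>) (h \<omega>))"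
    by simp
  also have "\<dots> = expectation (\<lambda>\<omega>. (\<Sum>b<s. \<Phi> b (h \<omega>)) / real s)"
    using expectation_next_selection[OF choice_facts fin notin, of \<Phi>] by (simp add: h_def)
  also have "\<dots> \<le> expectation (\<lambda>\<omega>. (1 - a / (real s * \<beta>A)) * dY k \<omega>)"
  proof (rule integral_mono)
    show "integrable M (\<lambda>\<omega>. (\<Sum>b<s. \<Phi> b (h \<omega>)) / real s)"
      unfolding h_def by (rule history_function_integrable[OF choice_facts fin])
    show "integrable M (\<lambda>\<omega>. (1 - a / (real s * \<beta>A)) * dY k \<omega>)"
      using integrable_errors by simp
    show "(\<Sum>b<s. \<Phi> b (h \<omega>)) / real s \<le> (1 - a / (real s * \<beta>A)) * dY k \<omega>" for \<omega>
      unfolding \<Phi>_def h dY Let_def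
      by (rule average_Y_step_error[OF conjunct1[OF arbk_invariant] a])
  qed
  finally show ?thesis by simp
qed

lemma expectation_dX_Suc:
  assumes c: "\<And>Z. Z \<in> carrier_mat q n \<Longrightarrow>
      c * mat_inner (B * Z) (B * Z)
        \<le> mat_inner (transpose_mat B * (B * Z)) (transpose_mat B * (B * Z))"
  shows "expectation (dX (Suc k))
    \<le> (1 - c / (real t * \<beta>B)) * expectation (dX k) + expectation (dY (Suc k)) / (real t * \<alpha>B)"
proof -
  \<comment> \<open>The column step uses the new \<open>Y\<close>, so the row selection of the same
    iteration belongs to the past; only the column selection is averaged, and
    \<open>dY (Suc k)\<close> remains in the bound.\<close>
  define K where "K = insert (Inl k) (history k)"
  define Y' where "Y' h = arbk_Y_step A F (U (h (Inl k))) (snd (arbk_of h k))" for h :: "nat + nat \<Rightarrow> nat"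
  define \<Phi> where "\<Phi> b h = (let D = arbk_X_step B (V b) (Y' h) (fst (arbk_of h k)) - Xs in mat_inner D D)"
    for b and h :: "nat + nat \<Rightarrow> nat"
  define h where "h \<omega> = restrict (\<lambda>a. choice_family a \<omega>) K" for \<omega>
  have fin: "finite K" by (simp add: K_def)
  have h: "arbk_of (h \<omega>) k = arbk A B F U V X0 (X0 * B) (\<lambda>l. i l \<omega>) (\<lambda>l. j l \<omega>) k" for \<omega>
    unfolding h_def by (rule arbk_of_restrict) (auto simp: K_def)
  have hk: "h \<omega> (Inl k) = i k \<omega>" for \<omega> by (simp add: h_def K_def)
  have Y': "Y' (h \<omega>) = snd (arbk A B F U V X0 (X0 * B) (\<lambda>l. i l \<omega>) (\<lambda>l. j l \<omega>) (Suc k))" for \<omega>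
    by (simp add: Y'_def h hk snd_arbk_Suc)
  have notin: "Inr k \<notin> K" by (auto simp: K_def)
  have "dX (Suc k) = (\<lambda>\<omega>. \<Phi> (choice_family (Inr k) \<omega>) (h \<omega>))"
    by (simp add: fun_eq_iff dX \<Phi>_def h Y' fst_arbk_Suc)
  then have "expectation (dX (Suc k)) = expectation (\<lambda>\<omega>. \<Phi> (choice_family (Inr k) \<omega>) (h \<omega>))"
    by simp
  also have "\<dots> = expectation (\<lambda>\<omega>. (\<Sum>b<t. \<Phi> b (h \<omega>)) / real t)"
    using expectation_next_selection[OF choice_facts fin notin, of \<Phi>] by (simp add: h_def)
  also have "\<dots> \<le> expectation (\<lambda>\<omega>. (1 - c / (real t * \<beta>B)) * dX k \<omega> + dY (Suc k) \<omega> / (real t * \<alpha>B))"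
  proof (rule integral_mono)
    show "integrable M (\<lambda>\<omega>. (\<Sum>b<t. \<Phi> b (h \<omega>)) / real t)"
      unfolding h_def by (rule history_function_integrable[OF choice_facts fin])
    show "integrable M (\<lambda>\<omega>. (1 - c / (real t * \<beta>B)) * dX k \<omega> + dY (Suc k) \<omega> / (real t * \<alpha>B))"
      using integrable_errors by simp
    show "(\<Sum>b<t. \<Phi> b (h \<omega>)) / real t
        \<le> (1 - c / (real t * \<beta>B)) * dX k \<omega> + dY (Suc k) \<omega> / (real t * \<alpha>B)" for \<omega>
      unfolding \<Phi>_def h Y' dX dY Let_def
      using average_X_step_error[OF conjunct2[OF arbk_invariant] conjunct1[OF conjunct1[OF arbk_invariant]] c] .
  qed
  also have "\<dots> = (1 - c / (real t * \<beta>B)) * expectation (dX k) + expectation (dY (Suc k)) / (real t * \<alpha>B)"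
    using integrable_errors by simp
  finally show ?thesis .
qed

end

end

section \<open>Convergence\<close>

text \<open>On the side of the smaller Gram matrix the lower and upper bounds both hold for every
  matrix; comparing them at the identity, which is nonzero, gives the inequality.\<close>

lemma sigma_min_power2_le:
  assumes C: "C \<in> carrier_mat r c" and dims: "0 < r" "0 < c" and K: "0 \<le> K"
    and le: "\<And>k W. W \<in> carrier_mat c k \<Longrightarrow> mat_inner (C * W) (C * W) \<le> K * mat_inner W W"
  shows "(sigma_min C)\<^sup>2 \<le> K"
proof -
  have pos: "0 < mat_inner (1\<^sub>m k) (1\<^sub>m k)" if "0 < k" for k
  proof -
    have "mat_inner (1\<^sub>m k) (1\<^sub>m k) \<noteq> 0"
      using mat_inner_self_eq_0D[OF one_carrier_mat, of k] that
      by (metis index_one_mat(1) index_zero_mat(1) zero_neq_one)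
    then show ?thesis using mat_inner_self_nonneg[of "1\<^sub>m k"] by simp
  qed
  show ?thesis
  proof (cases "r \<le> c")
    case True
    then have "small_gram C = C * transpose_mat C" using C by (simp add: small_gram_def)
    then have "(sigma_min C)\<^sup>2 * mat_inner (1\<^sub>m r) (1\<^sub>m r)
        \<le> mat_inner (transpose_mat C * 1\<^sub>m r) (transpose_mat C * 1\<^sub>m r)"
      using lambda_min_gram_le[OF C dims(1) one_carrier_mat] by (simp add: sigma_min_power2[OF C dims])
    also have "\<dots> \<le> K * mat_inner (1\<^sub>m r) (1\<^sub>m r)"
      by (rule mult_upper_bound_transpose[OF C K le one_carrier_mat])
    finally show ?thesis using pos[OF dims(1)] by simp
  next
    case False
    have C': "transpose_mat C \<in> carrier_mat c r" using C by simp
    have "small_gram C = transpose_mat C * C" using C False by (simp add: small_gram_def)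
    then have "(sigma_min C)\<^sup>2 * mat_inner (1\<^sub>m c) (1\<^sub>m c) \<le> mat_inner (C * 1\<^sub>m c) (C * 1\<^sub>m c)"
      using lambda_min_gram_le[OF C' dims(2) one_carrier_mat] by (simp add: sigma_min_power2[OF C dims])
    also have "\<dots> \<le> K * mat_inner (1\<^sub>m c) (1\<^sub>m c)" by (rule le[OF one_carrier_mat])
    finally show ?thesis using pos[OF dims(2)] by simp
  qed
qed

text \<open>
  Unlike \<open>sigma_min\<close>, which may vanish, this constant is always positive; it yields the
  contraction factors below 1 that linear convergence needs.
\<close>

lemma ex_coercive_on_row_space:
  assumes C: "C \<in> carrier_mat r c" and K: "0 < K"
  shows "\<exists>a>0. a \<le> K \<and> (\<forall>k. \<forall>Z\<in>carrier_mat r k.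
    a * mat_inner (transpose_mat C * Z) (transpose_mat C * Z)
      \<le> mat_inner (C * (transpose_mat C * Z)) (C * (transpose_mat C * Z)))"
proof -
  define \<kappa> where "\<kappa> = mat_inner (pinv C) (pinv C) + 1"
  have \<kappa>: "0 < \<kappa>" using mat_inner_self_nonneg[of "pinv C"] by (simp add: \<kappa>_def)
  \<comment> \<open>The cap by \<open>K\<close> keeps the resulting contraction factor
    \<open>1 - a / K\<close> nonnegative.\<close>
  define a where "a = min (1 / \<kappa>) K"
  have "a * mat_inner (transpose_mat C * Z) (transpose_mat C * Z)
      \<le> mat_inner (C * (transpose_mat C * Z)) (C * (transpose_mat C * Z))"
    if Z: "Z \<in> carrier_mat r k" for k Z
  proof -
    let ?Y = "transpose_mat C * Z"
    have "mat_inner ?Y ?Y \<le> \<kappa> * mat_inner (C * ?Y) (C * ?Y)"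
      using pinv_bound_transpose[OF C Z] mat_inner_self_nonneg[of "C * ?Y"]
      by (simp add: \<kappa>_def algebra_simps)
    then have "1 / \<kappa> * mat_inner ?Y ?Y \<le> mat_inner (C * ?Y) (C * ?Y)" using \<kappa> by (simp add: field_simps)
    moreover have "a * mat_inner ?Y ?Y \<le> 1 / \<kappa> * mat_inner ?Y ?Y"
      by (intro mult_right_mono mat_inner_self_nonneg) (simp add: a_def)
    ultimately show ?thesis by simp
  qed
  moreover have "0 < a" "a \<le> K" using \<kappa> K by (auto simp: a_def)
  ultimately show ?thesis by blast
qed

text \<open>The paving bound controls the transpose of the block, and equality of operator norms
  carries it over to the block.\<close>

lemma lambda_max_gram_mult_le:
  assumes R: "R \<in> carrier_mat r n" and r: "0 < r" and \<beta>: "0 \<le> \<beta>" "lambda_max (R * transpose_mat R) \<le> \<beta>"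
    and W: "W \<in> carrier_mat n k"
  shows "mat_inner (R * W) (R * W) \<le> \<beta> * mat_inner W W"
proof -
  have "mat_inner (transpose_mat R * Z) (transpose_mat R * Z) \<le> \<beta> * mat_inner Z Z"
    if Z: "Z \<in> carrier_mat r k" for Z
    using lambda_max_gram_ge[OF R r Z] mult_right_mono[OF \<beta>(2) mat_inner_self_nonneg[of Z]] by simp
  then show ?thesis using mult_upper_bound_transpose[of "transpose_mat R" n r \<beta> k W] R W \<beta>(1) by simp
qed

section \<open>The coupled scalar recursion\<close>

context
  fixes d e :: "nat \<Rightarrow> real" and g h w :: real
  assumes e_Suc: "\<And>k. e (Suc k) \<le> g * e k" and d_Suc: "\<And>k. d (Suc k) \<le> h * d k + e (Suc k) / w"
    and e_nonneg: "0 \<le> e 0" and d_nonneg: "0 \<le> d 0" and g: "0 \<le> g" and h: "0 \<le> h" and w: "0 < w"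
begin

lemma coupled_recursion_geometric: "e k \<le> g ^ k * e 0"
proof (induction k)
  case (Suc k)
  have "e (Suc k) \<le> g * (g ^ k * e 0)" using e_Suc[of k] mult_left_mono[OF Suc g] by simp
  then show ?case by (simp add: mult.assoc)
qed simp

text \<open>Each step contributes at most \<open>g ^ Suc k * e 0 / w\<close>. Factoring out
  \<open>h ^ Suc k\<close> turns this into the next summand, and \<open>v\<close> expresses
  \<open>e 0\<close> through \<open>d 0\<close>.\<close>

lemma coupled_recursion_explicit:
  assumes h0: "h \<noteq> 0" and v: "e 0 \<le> v * d 0"
  shows "d k \<le> (1 + v / w * (\<Sum>l<k. g ^ (l + 1) / h ^ (l + 1))) * h ^ k * d 0"
proof (induction k)
  case (Suc k)
  let ?S = "\<lambda>k. \<Sum>l<k. g ^ (l + 1) / h ^ (l + 1)"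
  have "e (Suc k) \<le> g ^ Suc k * (v * d 0)"
    using coupled_recursion_geometric[of "Suc k"] mult_left_mono[OF v zero_le_power[OF g, of "Suc k"]] by simp
  then have "e (Suc k) / w \<le> g ^ Suc k * (v * d 0) / w" using w by (simp add: divide_right_mono)
  moreover have "h * d k \<le> h * ((1 + v / w * ?S k) * h ^ k * d 0)" by (rule mult_left_mono[OF Suc h])
  ultimately have "d (Suc k) \<le> h * ((1 + v / w * ?S k) * h ^ k * d 0) + g ^ Suc k * (v * d 0) / w"
    using d_Suc[of k] by simp
  also have "g ^ Suc k * (v * d 0) / w = v / w * (g ^ (k + 1) / h ^ (k + 1)) * h ^ Suc k * d 0"
    using h0 by simp
  also have "h * ((1 + v / w * ?S k) * h ^ k * d 0) + \<dots> = (1 + v / w * ?S (Suc k)) * h ^ Suc k * d 0"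
    by (simp add: algebra_simps)
  finally show ?case .
qed simp

lemma coupled_recursion_linear:
  assumes g1: "g < 1" and h1: "h < 1"
  shows "\<exists>C \<rho>. 0 \<le> C \<and> 0 \<le> \<rho> \<and> \<rho> < 1 \<and> (\<forall>k. d k \<le> C * \<rho> ^ k)"
proof -
  \<comment> \<open>For \<open>g = h\<close> the sum of powers may grow linearly against
    \<open>h ^ k\<close>, so the rate is placed strictly above both factors, midway to 1.\<close>
  define \<rho> where "\<rho> = (1 + max g h) / 2"
  have \<rho>: "g < \<rho>" "h < \<rho>" "\<rho> < 1" "0 < \<rho>" using g h g1 h1 by (auto simp: \<rho>_def max_def)
  \<comment> \<open>Chosen so that \<open>(\<rho> - h) * C\<close> absorbs the inhomogeneous term
    and the induction closes.\<close>
  define C where "C = d 0 + e 0 / (w * (\<rho> - h))"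
  have C: "0 \<le> C" using d_nonneg e_nonneg w \<rho> by (auto simp: C_def)
  have key: "h * C + \<rho> * e 0 / w \<le> \<rho> * C"
  proof -
    have "\<rho> * e 0 / w \<le> e 0 / w" using \<rho> e_nonneg w by (intro divide_right_mono mult_left_le_one_le) auto
    also have "\<dots> = (\<rho> - h) * (e 0 / (w * (\<rho> - h)))" using \<rho> by simp
    also have "\<dots> \<le> (\<rho> - h) * C" using \<rho> d_nonneg by (intro mult_left_mono) (auto simp: C_def)
    finally show ?thesis by (simp add: algebra_simps)
  qed
  have "d k \<le> C * \<rho> ^ k" for k
  proof (induction k)
    case 0
    show ?case using w e_nonneg \<rho> by (simp add: C_def)
  next
    case (Suc k)
    have "e (Suc k) \<le> \<rho> ^ Suc k * e 0"
      using coupled_recursion_geometric[of "Suc k"] mult_right_mono[OF power_mono[of g \<rho> "Suc k"] e_nonneg] \<rho> g by simp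
    then have "e (Suc k) / w \<le> \<rho> ^ Suc k * e 0 / w" using w by (simp add: divide_right_mono)
    then have "d (Suc k) \<le> h * (C * \<rho> ^ k) + \<rho> ^ Suc k * e 0 / w"
      using d_Suc[of k] mult_left_mono[OF Suc h] by simp
    also have "\<dots> = (h * C + \<rho> * e 0 / w) * \<rho> ^ k" by (simp add: algebra_simps)
    also have "\<dots> \<le> \<rho> * C * \<rho> ^ k" using key \<rho> by (intro mult_right_mono) auto
    finally show ?case by (simp add: algebra_simps)
  qed
  then show ?thesis using C \<rho> by (intro exI[of _ C] exI[of _ \<rho>]) auto
qed

end

section \<open>From the ARBK hypotheses to the two convergence claims\<close>

theorem theorem3p3:
  fixes A B F Ystar Xstar X0 Y0 :: "real mat"
    and m n p q s t :: nat
    and \<pi>U \<pi>V :: "nat \<Rightarrow> nat"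
    and U V :: "nat \<Rightarrow> nat set"
    and S T :: "nat set set"
    and \<beta>A \<alpha>B \<beta>B \<gamma>hat \<gamma>tilde :: real
    and \<gamma>bar :: "nat \<Rightarrow> real"
    and M :: "'w measure"
    and i j :: "nat \<Rightarrow> 'w \<Rightarrow> nat"
    and X :: "nat \<Rightarrow> 'w \<Rightarrow> real mat"
  assumes dims: "0 < m" "0 < n" "0 < p" "0 < q"
    and A: "A \<in> carrier_mat m n"
    and B: "B \<in> carrier_mat p q"
    and F: "F \<in> carrier_mat m q"
    and Ystar: "Ystar = pinv A * F"
    and Xstar: "Xstar = pinv A * F * pinv B"
    and consistent_Y: "\<exists>Y \<in> carrier_mat n q. A * Y = F"
    and consistent_X: "\<exists>X \<in> carrier_mat n p. X * B = Ystar"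
    and s: "1 \<le> s" "s \<le> m"
    and t: "1 \<le> t" "t \<le> q"
    and perm_U: "\<pi>U permutes {..<m}"
    and perm_V: "\<pi>V permutes {..<q}"
    and U: "U = part_block \<pi>U m s"
    and V: "V = part_block \<pi>V q t"
    and S: "S = U ` {..<s}"
    and T: "T = V ` {..<t}"
    and \<beta>A: "0 < \<beta>A" "upper_row_paving_bound A S \<beta>A"
    and \<alpha>B: "0 < \<alpha>B" "lower_col_paving_bound B T \<alpha>B"
    and \<beta>B: "0 < \<beta>B" "upper_col_paving_bound B T \<beta>B"
    and X0: "X0 \<in> carrier_mat n p"
    and Y0: "Y0 = X0 * B"
    and X0_range: "\<exists>Z \<in> carrier_mat n q. X0 = Z * transpose_mat B"
    and Y0_range: "\<exists>Z' \<in> carrier_mat m q. Y0 = transpose_mat A * Z'"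
    and \<gamma>hat: "\<gamma>hat = 1 - (sigma_min A)\<^sup>2 / (real s * \<beta>A)"
    and \<gamma>tilde: "\<gamma>tilde = 1 - (sigma_min B)\<^sup>2 / (real t * \<beta>B)"
    and \<gamma>tilde_nz: "\<gamma>tilde \<noteq> 0"
    and \<gamma>bar: "\<And>k. \<gamma>bar k =
      1 + (sigma_max B)\<^sup>2 / (real t * \<alpha>B) * (\<Sum>l=0..k. \<gamma>hat ^ (l + 1) / \<gamma>tilde ^ (l + 1))"
    and prob: "prob_space M"
    and selections: "random_selections M s t i j"
    and X: "\<And>k \<omega>. X k \<omega> = fst (arbk A B F U V X0 Y0 (\<lambda>l. i l \<omega>) (\<lambda>l. j l \<omega>) k)"
  shows "linear_mean_square_convergence M X Xstar \<and>
    (\<forall>k. (\<integral>\<omega>. (frobenius_norm (X (k + 1) \<omega> - Xstar))\<^sup>2 \<partial>M)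
      \<le> \<gamma>bar k * \<gamma>tilde ^ (k + 1) * (frobenius_norm (X0 - Xstar))\<^sup>2)"
proof -
  interpret prob_space M by (rule prob)
  have s0: "0 < s" and t0: "0 < t" using s t by auto
  have BT: "transpose_mat B \<in> carrier_mat q p" using B by simp
  have PA: "pinv A \<in> carrier_mat n m" by (rule pinv_carrier[OF A])
  have PB: "pinv B \<in> carrier_mat q p" by (rule pinv_carrier[OF B])
  have Ys: "Ystar \<in> carrier_mat n q" unfolding Ystar using PA F by simp
  have AYs: "A * Ystar = F"
  proof -
    obtain Y where Y: "Y \<in> carrier_mat n q" "A * Y = F" using consistent_Y by auto
    have "A * (pinv A * A) * Y = A * (pinv A * (A * Y))" using A PA Y by (simp add: mult_assoc_dim)
    then show ?thesis by (simp add: Ystar Y mult_pinv_mult)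
  qed
  have Xs_eq: "Xstar = Ystar * pinv B" by (simp add: Xstar Ystar)
  have Xs: "Xstar \<in> carrier_mat n p" unfolding Xs_eq using Ys PB by simp
  have XsB: "Xstar * B = Ystar"
  proof -
    obtain X' where X': "X' \<in> carrier_mat n p" "X' * B = Ystar" using consistent_X by auto
    have "X' * (B * (pinv B * B)) = X' * B * pinv B * B" using B PB X'(1) by (simp add: mult_assoc_dim)
    then show ?thesis by (simp add: Xs_eq X' mult_pinv_mult)
  qed
  \<comment> \<open>\<open>X0 * B\<close> lies in the range of \<open>transpose_mat A\<close> by
    assumption and \<open>pinv A * F\<close> by the factorization of the pseudoinverse; hence so
    does their difference.\<close>
  have Y0_inv: "\<exists>Z\<in>carrier_mat m q. X0 * B - Ystar = transpose_mat A * Z"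
  proof -
    obtain Z where Z: "Z \<in> carrier_mat m q" "X0 * B = transpose_mat A * Z" using Y0_range Y0 by auto
    define Z' where "Z' = transpose_mat (pinv A) * (pinv A * F)"
    have Z': "Z' \<in> carrier_mat m q" unfolding Z'_def using PA F by simp
    have "transpose_mat A * (transpose_mat (pinv A) * pinv A) * F = transpose_mat A * Z'"
      unfolding Z'_def using A PA F by (simp add: mult_assoc_dim)
    then have "Ystar = transpose_mat A * Z'" by (simp add: Ystar flip: pinv_eq_transpose_mult)
    then have "X0 * B - Ystar = transpose_mat A * (Z - Z')"
      using Z Z' A by (simp add: mult_minus_distrib_dim)
    then show ?thesis using minus_carrier_mat[OF Z'] by blast
  qed
  have X0_inv: "\<exists>Z\<in>carrier_mat q n. transpose_mat (X0 - Xstar) = B * Z"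
  proof -
    obtain Z where Z: "Z \<in> carrier_mat n q" "X0 = Z * transpose_mat B" using X0_range by auto
    define P where "P = pinv (transpose_mat B)"
    have P: "P \<in> carrier_mat p q" unfolding P_def by (rule pinv_carrier[OF BT])
    define Z' where "Z' = transpose_mat P * (P * transpose_mat Ystar)"
    have Z': "Z' \<in> carrier_mat q n" unfolding Z'_def using P Ys by simp
    have "B * (transpose_mat P * P) * transpose_mat Ystar = B * Z'"
      unfolding Z'_def using B P Ys by (simp add: mult_assoc_dim)
    moreover have "B * (transpose_mat P * P) = P"
      using pinv_eq_transpose_mult[of "transpose_mat B"] by (simp add: P_def)
    ultimately have "P * transpose_mat Ystar = B * Z'" by simp
    moreover have "transpose_mat Xstar = P * transpose_mat Ystar"
      unfolding Xs_eq P_def pinv_transpose using Ys PB by (simp add: transpose_mult_dim)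
    moreover have "transpose_mat X0 = B * transpose_mat Z"
      unfolding Z(2) using Z(1) B by (simp add: transpose_mult_dim)
    ultimately have "transpose_mat (X0 - Xstar) = B * (transpose_mat Z - Z')"
      using transpose_minus[OF X0 Xs] Z(1) Z' B by (simp add: mult_minus_distrib_dim)
    then show ?thesis using minus_carrier_mat[OF Z'] by blast
  qed
  have A_le: "mat_inner (rows_of A (U b) * W) (rows_of A (U b) * W) \<le> \<beta>A * mat_inner W W"
    if b: "b < s" and W: "W \<in> carrier_mat n k" for b k W
  proof (rule lambda_max_gram_mult_le[OF _ _ less_imp_le[OF \<beta>A(1)] _ W])
    show "rows_of A (U b) \<in> carrier_mat (dim_row (rows_of A (U b))) n" using A by (auto simp: dim_rows_of)
    show "0 < dim_row (rows_of A (U b))"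
      unfolding U by (rule dim_row_rows_of_part_block_pos[OF A perm_U s0 s(2) b])
    show "lambda_max (rows_of A (U b) * transpose_mat (rows_of A (U b))) \<le> \<beta>A"
      using \<beta>A(2) b by (auto simp: upper_row_paving_bound_def S)
  qed
  define R where "R b = rows_of (transpose_mat B) (V b)" for b
  have R: "R b \<in> carrier_mat (dim_row (R b)) p" for b using BT by (auto simp: R_def dim_rows_of)
  have R_pos: "0 < dim_row (R b)" if "b < t" for b
    unfolding R_def V by (rule dim_row_rows_of_part_block_pos[OF BT perm_V t0 t(2) that])
  have gram_V: "transpose_mat (cols_of B (V b)) * cols_of B (V b) = R b * transpose_mat (R b)" for b
    by (simp add: cols_of_eq R_def)
  have B_le: "mat_inner (R b * W) (R b * W) \<le> \<beta>B * mat_inner W W"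
    if b: "b < t" and W: "W \<in> carrier_mat p k" for b k W
  proof (rule lambda_max_gram_mult_le[OF R R_pos[OF b] less_imp_le[OF \<beta>B(1)] _ W])
    show "lambda_max (R b * transpose_mat (R b)) \<le> \<beta>B"
      using \<beta>B(2) b by (auto simp: upper_col_paving_bound_def T simp flip: gram_V)
  qed
  have B_ge: "\<alpha>B * mat_inner Z Z \<le> mat_inner (transpose_mat (R b) * Z) (transpose_mat (R b) * Z)"
    if b: "b < t" and Z: "Z \<in> carrier_mat (dim_row (R b)) k" for b k Z
  proof -
    have "\<alpha>B \<le> lambda_min (R b * transpose_mat (R b))"
      using \<alpha>B(2) b by (auto simp: lower_col_paving_bound_def T simp flip: gram_V)
    then have "\<alpha>B * mat_inner Z Z \<le> lambda_min (R b * transpose_mat (R b)) * mat_inner Z Z"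
      by (intro mult_right_mono mat_inner_self_nonneg)
    also have "\<dots> \<le> mat_inner (transpose_mat (R b) * Z) (transpose_mat (R b) * Z)"
      by (rule lambda_min_gram_le[OF R R_pos[OF b] Z])
    finally show ?thesis .
  qed
  define dX where "dX k \<omega> =
      (let D = fst (arbk A B F U V X0 (X0 * B) (\<lambda>l. i l \<omega>) (\<lambda>l. j l \<omega>) k) - Xstar in mat_inner D D)" for k \<omega>
  define dY where "dY k \<omega> =
      (let D = snd (arbk A B F U V X0 (X0 * B) (\<lambda>l. i l \<omega>) (\<lambda>l. j l \<omega>) k) - Ystar in mat_inner D D)" for k \<omega>
  have dX: "(frobenius_norm (X k \<omega> - Xstar))\<^sup>2 = dX k \<omega>" for k \<omega>
    by (simp add: X Y0 dX_def frobenius_norm_power2 Let_def)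
  note setting = A B X0 Ys AYs Xs XsB Y0_inv X0_inv perm_U perm_V s0 t0 U V \<beta>A(1) \<alpha>B(1) \<beta>B(1)
  note random = prob selections dX_def dY_def
  note block_bounds = A_le B_le[unfolded R_def] B_ge[unfolded R_def]
  have integrable_dX: "integrable M (dX k)" for k
    by (rule integrable_errors(1)[OF setting _ _ _ random]; erule (1) block_bounds)
  have Y_rec: "expectation (dY (Suc k)) \<le> (1 - a / (real s * \<beta>A)) * expectation (dY k)"
    if "\<And>Z. Z \<in> carrier_mat m q \<Longrightarrow>
      a * mat_inner (transpose_mat A * Z) (transpose_mat A * Z)
        \<le> mat_inner (A * (transpose_mat A * Z)) (A * (transpose_mat A * Z))" for a k
    by (rule expectation_dY_Suc[OF setting _ _ _ random]; (erule that | erule (1) block_bounds))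
  have X_rec: "expectation (dX (Suc k))
      \<le> (1 - c / (real t * \<beta>B)) * expectation (dX k) + expectation (dY (Suc k)) / (real t * \<alpha>B)"
    if "\<And>Z. Z \<in> carrier_mat q n \<Longrightarrow> c * mat_inner (B * Z) (B * Z)
        \<le> mat_inner (transpose_mat B * (B * Z)) (transpose_mat B * (B * Z))" for c k
    by (rule expectation_dX_Suc[OF setting _ _ _ random]; (erule that | erule (1) block_bounds))
  define d where "d k = expectation (dX k)" for k
  define e where "e k = expectation (dY k)" for k
  have "dX 0 = (\<lambda>_. mat_inner (X0 - Xstar) (X0 - Xstar))" by (simp add: fun_eq_iff dX_def Let_def)
  then have d0: "d 0 = mat_inner (X0 - Xstar) (X0 - Xstar)" by (simp add: d_def prob_space)
  have "dY 0 = (\<lambda>_. mat_inner (X0 * B - Ystar) (X0 * B - Ystar))" by (simp add: fun_eq_iff dY_def Let_def)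
  then have e0: "e 0 = mat_inner (X0 * B - Ystar) (X0 * B - Ystar)" by (simp add: e_def prob_space)
  have d0_nonneg: "0 \<le> d 0" and e0_nonneg: "0 \<le> e 0" by (simp_all add: d0 e0 mat_inner_self_nonneg)
  define w where "w = real t * \<alpha>B"
  have w: "0 < w" using t0 \<alpha>B(1) by (simp add: w_def)
  have s\<beta>: "0 < real s * \<beta>A" and t\<beta>: "0 < real t * \<beta>B" using s0 t0 \<beta>A(1) \<beta>B(1) by simp_all

  have "linear_mean_square_convergence M X Xstar"
  proof -
    obtain a where a: "0 < a" "a \<le> real s * \<beta>A" and a_le: "\<And>k Z. Z \<in> carrier_mat m k \<Longrightarrow>
        a * mat_inner (transpose_mat A * Z) (transpose_mat A * Z)
          \<le> mat_inner (A * (transpose_mat A * Z)) (A * (transpose_mat A * Z))"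
      using ex_coercive_on_row_space[OF A s\<beta>] by blast
    obtain c where c: "0 < c" "c \<le> real t * \<beta>B" and c_le: "\<And>k Z. Z \<in> carrier_mat q k \<Longrightarrow>
        c * mat_inner (B * Z) (B * Z) \<le> mat_inner (transpose_mat B * (B * Z)) (transpose_mat B * (B * Z))"
      using ex_coercive_on_row_space[OF BT t\<beta>] by auto
    have "\<exists>C \<rho>. 0 \<le> C \<and> 0 \<le> \<rho> \<and> \<rho> < 1 \<and> (\<forall>k. d k \<le> C * \<rho> ^ k)"
    proof (rule coupled_recursion_linear[where d = d and e = e])
      show "e (Suc k) \<le> (1 - a / (real s * \<beta>A)) * e k" for k
        unfolding e_def by (rule Y_rec[OF a_le])
      show "d (Suc k) \<le> (1 - c / (real t * \<beta>B)) * d k + e (Suc k) / w" for k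
        unfolding d_def e_def w_def by (rule X_rec[OF c_le])
    qed (use a c s\<beta> t\<beta> w d0_nonneg e0_nonneg in \<open>simp_all add: field_simps\<close>)
    then show ?thesis
      unfolding linear_mean_square_convergence_def dX using integrable_dX by (simp add: d_def)
  qed
  moreover have "expectation (\<lambda>\<omega>. (frobenius_norm (X (k + 1) \<omega> - Xstar))\<^sup>2)
      \<le> \<gamma>bar k * \<gamma>tilde ^ (k + 1) * (frobenius_norm (X0 - Xstar))\<^sup>2" for k
  proof -
    have "(sigma_min A)\<^sup>2 \<le> real s * \<beta>A"
    proof (rule sigma_min_power2_le[OF A dims(1,2)])
      show "mat_inner (A * W) (A * W) \<le> real s * \<beta>A * mat_inner W W" if "W \<in> carrier_mat n k" for k W
        by (rule mult_le_of_blocks[OF A perm_U s0 \<beta>A(1) refl _ that]; erule (1) A_le[unfolded U])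
    qed (use s\<beta> in simp)
    then have g: "0 \<le> \<gamma>hat" using s\<beta> by (simp add: \<gamma>hat)
    have "(sigma_min B)\<^sup>2 \<le> real t * \<beta>B"
    proof (rule sigma_min_power2_le[OF B dims(3,4)])
      fix k and W :: "real mat" assume W: "W \<in> carrier_mat q k"
      have "mat_inner (transpose_mat B * Z) (transpose_mat B * Z) \<le> real t * \<beta>B * mat_inner Z Z"
        if "Z \<in> carrier_mat p k" for Z
        by (rule mult_le_of_blocks[OF BT perm_V t0 \<beta>B(1) refl _ that]; erule (1) B_le[unfolded R_def V])
      then show "mat_inner (B * W) (B * W) \<le> real t * \<beta>B * mat_inner W W"
        using mult_upper_bound_transpose[OF BT less_imp_le[OF t\<beta>] _ W] by simp
    qed (use t\<beta> in simp)
    then have h: "0 \<le> \<gamma>tilde" using t\<beta> by (simp add: \<gamma>tilde)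
    \<comment> \<open>The initial error of \<open>Y\<close> is the initial error of \<open>X\<close>
      times \<open>B\<close>. This is where the factor \<open>sigma_max\<close> of the final bound
      originates.\<close>
    have e0_le: "e 0 \<le> (sigma_max B)\<^sup>2 * d 0"
    proof -
      have XX: "X0 - Xstar \<in> carrier_mat n p" using Xs by (rule minus_carrier_mat)
      have "X0 * B - Ystar = (X0 - Xstar) * B"
        unfolding XsB[symmetric] by (rule minus_mult_distrib_mat[OF X0 Xs B, symmetric])
      moreover have "(X0 - Xstar) * B \<in> carrier_mat n q" using XX B by simp
      ultimately have "e 0 = mat_inner (transpose_mat ((X0 - Xstar) * B)) (transpose_mat ((X0 - Xstar) * B))"
        by (simp add: e0 mat_inner_transpose)
      also have "transpose_mat ((X0 - Xstar) * B) = transpose_mat B * transpose_mat (X0 - Xstar)"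
        by (rule transpose_mult[OF XX B])
      finally have "e 0 \<le> (sigma_max B)\<^sup>2 * mat_inner (transpose_mat (X0 - Xstar)) (transpose_mat (X0 - Xstar))"
        using sigma_max_ge_transpose[OF B dims(3,4), of "transpose_mat (X0 - Xstar)" n] XX by simp
      then show ?thesis by (simp add: d0 mat_inner_transpose[OF XX XX])
    qed
    have "d (Suc k) \<le> (1 + (sigma_max B)\<^sup>2 / w * (\<Sum>l<Suc k. \<gamma>hat ^ (l + 1) / \<gamma>tilde ^ (l + 1)))
        * \<gamma>tilde ^ Suc k * d 0"
    proof (rule coupled_recursion_explicit[where d = d and e = e])
      show "e (Suc k) \<le> \<gamma>hat * e k" for k
        unfolding e_def \<gamma>hat by (rule Y_rec[OF sigma_min_le_transpose[OF A dims(1,2)]])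
      show "d (Suc k) \<le> \<gamma>tilde * d k + e (Suc k) / w" for k
        unfolding d_def e_def w_def \<gamma>tilde by (rule X_rec[OF sigma_min_le[OF B dims(3,4)]])
    qed (fact e0_nonneg d0_nonneg g h w \<gamma>tilde_nz e0_le)+
    moreover have "{..<Suc k} = {0..k}" by auto
    ultimately show ?thesis
      unfolding dX by (simp add: d_def[symmetric] d0 \<gamma>bar w_def frobenius_norm_power2)
  qed
  ultimately show ?thesis by blast
qed

end
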